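(* Let $A$ be the generator of a $C_0$-semigroup on a complex Banach space $X$, and assume that for some $c>0$ one has $\|Ax\| \ge c\|x\|$ for all $x \in D(A)$. Then there exist a Banach space $Y \supseteq X$ and an operator $B$ on $Y$ with the following properties: (a) $B$ is the generator of a $C_0$-semigroup on $Y$; (b) $B$ is an outer extension of $A$; (c) $B$ is invertible with $\|B^{-1}\| \le c^{-1}$, and $\sigma(B) \subseteq \sigma(A)$; (d) there is a unital isometric algebra homomorphism $\varphi : \{A\}' \to \mathcal{B}(Y)$ such that $\varphi(U)$ is an extension of $U$ for all $U \in \{A\}'$ and $\varphi(R(\lambda,A)) = R(\lambda,B)$ for all $\lambda \in \rho(A)$.
   Context: All Banach spaces are complex, and $\mathcal{B}(X)$ denotes the bounded linear operators on $X$. An operator $A$ on $X$ is a (possibly unbounded) linear map from a subspace $D(A)\subseteq X$ into $X$; $\sigma(A)$, $\rho(A)$ are its spectrum and resolvent set, and $R(\lambda,A)=(\lambda-A)^{-1}$ for $\lambda\in\rho(A)$. $B$ invertible means that $B$ is a bijection of $D(B)$ onto $Y$ with bounded inverse $B^{-1}\in\mathcal{B}(Y)$. $Y \supseteq X$ means that $X$ is a closed subspace of $Y$ with the same norm (up to identification via a linear isometric embedding of $X$ into $Y$). An operator $B$ on $Y\supseteq X$ is an extension of $A$ if $D(A)\subseteq D(B)$ and $Bx=Ax$ for $x\in D(A)$; it is an outer extension of $A$ if $D(A)=D(B)\cap X$ and $Bx=Ax$ for all $x\in D(A)$. The commutant of $A$ is $\{A\}' = \{U \in \mathcal{B}(X):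 \text{for all } x \in D(A),\ Ux \in D(A) \text{ and } AUx=UAx\}$. *)

theory Defs
  imports "HOL-Analysis.Analysis"
begin

section \<open>Complex Banach spaces\<close>

text \<open>
  The given space is a type of class \<open>cbanach\<close>. The space whose existence is asserted cannot be
  a type, since HOL does not quantify over types inside a formula; it is a structure on a carrier
  set. So that every operator-theoretic notion is defined only once, all of them are defined for
  carrier-based spaces, and a type of class \<open>cbanach\<close> is regarded as the space \<open>univ_space\<close>.

  A space asserted to exist over \<open>'a\<close> has its carrier inside the type \<open>(nat \<Rightarrow> 'a) set\<close>, which
  is large enough for the cosets in any quotient of a space of sequences in \<open>'a\<close>.
\<close>

class cbanach = banach +
  fixes scaleC :: "complex \<Rightarrow> 'a \<Rightarrow> 'a" (infixr "*\<^sub>C" 75)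
  assumes scaleC_add_right: "a *\<^sub>C (x + y) = a *\<^sub>C x + a *\<^sub>C y"
    and scaleC_add_left: "(a + b) *\<^sub>C x = a *\<^sub>C x + b *\<^sub>C x"
    and scaleC_scaleC: "a *\<^sub>C (b *\<^sub>C x) = (a * b) *\<^sub>C x"
    and scaleC_of_real: "complex_of_real r *\<^sub>C x = r *\<^sub>R x"
    and norm_scaleC: "norm (a *\<^sub>C x) = cmod a * norm x"

record 'v cspace =
  pts :: "'v set"
  vzero :: 'v
  vadd :: "'v \<Rightarrow> 'v \<Rightarrow> 'v"
  vscale :: "complex \<Rightarrow> 'v \<Rightarrow> 'v"
  vnorm :: "'v \<Rightarrow> real"

definition vdiff :: "'v cspace \<Rightarrow> 'v \<Rightarrow> 'v \<Rightarrow> 'v" where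
  "vdiff V x y = vadd V x (vscale V (-1) y)"

definition vdist :: "'v cspace \<Rightarrow> 'v \<Rightarrow> 'v \<Rightarrow> real" where
  "vdist V x y = vnorm V (vdiff V x y)"

locale complex_banach_space =
  fixes V :: "'v cspace"
  assumes zero_closed: "vzero V \<in> pts V"
    and add_closed: "\<lbrakk>x \<in> pts V; y \<in> pts V\<rbrakk> \<Longrightarrow> vadd V x y \<in> pts V"
    and scale_closed: "x \<in> pts V \<Longrightarrow> vscale V a x \<in> pts V"
    and add_assoc: "\<lbrakk>x \<in> pts V; y \<in> pts V; z \<in> pts V\<rbrakk>
      \<Longrightarrow> vadd V (vadd V x y) z = vadd V x (vadd V y z)"
    and add_commute: "\<lbrakk>x \<in> pts V; y \<in> pts V\<rbrakk> \<Longrightarrow> vadd V x y = vadd V y x"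
    and add_zero: "x \<in> pts V \<Longrightarrow> vadd V (vzero V) x = x"
    and add_inverse: "x \<in> pts V \<Longrightarrow> \<exists>y\<in>pts V. vadd V x y = vzero V"
    and scale_add_right: "\<lbrakk>x \<in> pts V; y \<in> pts V\<rbrakk>
      \<Longrightarrow> vscale V a (vadd V x y) = vadd V (vscale V a x) (vscale V a y)"
    and scale_add_left: "x \<in> pts V
      \<Longrightarrow> vscale V (a + b) x = vadd V (vscale V a x) (vscale V b x)"
    and scale_scale: "x \<in> pts V \<Longrightarrow> vscale V a (vscale V b x) = vscale V (a * b) x"
    and scale_one: "x \<in> pts V \<Longrightarrow> vscale V 1 x = x"
    and norm_nonneg: "x \<in> pts V \<Longrightarrow> 0 \<le> vnorm V x"
    and norm_eq_zero: "x \<in> pts V \<Longrightarrow> vnorm V x = 0 \<longleftrightarrow> x = vzero V"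
    and norm_scale: "x \<in> pts V \<Longrightarrow> vnorm V (vscale V a x) = cmod a * vnorm V x"
    and norm_triangle: "\<lbrakk>x \<in> pts V; y \<in> pts V\<rbrakk>
      \<Longrightarrow> vnorm V (vadd V x y) \<le> vnorm V x + vnorm V y"
    and complete: "Metric_space.mcomplete (pts V) (vdist V)"

definition univ_space :: "'a::cbanach cspace" where
  "univ_space = \<lparr>pts = UNIV, vzero = 0, vadd = (+), vscale = scaleC, vnorm = norm\<rparr>"

lemma univ_space_simps [simp]:
  "pts univ_space = UNIV" "vzero univ_space = 0" "vadd univ_space = (+)"
  "vscale univ_space = scaleC" "vnorm univ_space = norm"
  by (simp_all add: univ_space_def)

lemma vdiff_univ_space [simp]: "vdiff univ_space x y = x - y"
proof -
  have "(-1) *\<^sub>C y = - y"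
    using scaleC_of_real[of "-1" y] by simp
  then show ?thesis by (simp add: vdiff_def)
qed

lemma complex_banach_space_univ_space:
  "complex_banach_space (univ_space :: 'a::cbanach cspace)"
proof
  have "vdist (univ_space :: 'a cspace) = dist"
    by (intro ext) (simp add: vdist_def dist_norm)
  then show "Metric_space.mcomplete (pts univ_space) (vdist (univ_space :: 'a cspace))"
    by (simp add: complete_UNIV)
  show "vscale univ_space 1 x = x" for x :: 'a
    using scaleC_of_real[of 1 x] by simp
  show "\<exists>y\<in>pts univ_space. vadd univ_space x y = vzero univ_space" for x :: 'a
    by (auto intro!: exI[of _ "- x"])
qed (auto simp: add_ac scaleC_add_right scaleC_add_left scaleC_scaleC norm_scaleC norm_triangle_ineq)

definition isometric_embedding :: "'v cspace \<Rightarrow> 'w cspace \<Rightarrow> ('v \<Rightarrow> 'w) \<Rightarrow> bool" where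
  "isometric_embedding V W j \<longleftrightarrow>
     j ` pts V \<subseteq> pts W \<and>
     (\<forall>x\<in>pts V. \<forall>y\<in>pts V. j (vadd V x y) = vadd W (j x) (j y)) \<and>
     (\<forall>a. \<forall>x\<in>pts V. j (vscale V a x) = vscale W a (j x)) \<and>
     (\<forall>x\<in>pts V. vnorm W (j x) = vnorm V x)"


section \<open>Bounded operators\<close>

text \<open>
  A bounded operator is a total function of which only the values on the carrier matter.
  Equality of bounded operators therefore means equality on the carrier.
\<close>

definition bounded_ops :: "'v cspace \<Rightarrow> ('v \<Rightarrow> 'v) set" where
  "bounded_ops V = {U.
     U ` pts V \<subseteq> pts V \<and>
     (\<forall>x\<in>pts V. \<forall>y\<in>pts V. U (vadd V x y) = vadd V (U x) (U y)) \<and>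
     (\<forall>a. \<forall>x\<in>pts V. U (vscale V a x) = vscale V a (U x)) \<and>
     (\<exists>K. \<forall>x\<in>pts V. vnorm V (U x) \<le> K * vnorm V x)}"

text \<open>As in \<^const>\<open>onorm\<close>, the quotient is \<open>0\<close> at the zero vector.\<close>

definition op_norm :: "'v cspace \<Rightarrow> ('v \<Rightarrow> 'v) \<Rightarrow> real" where
  "op_norm V U = (SUP x\<in>pts V. vnorm V (U x) / vnorm V x)"

lemma op_norm_univ_space: "op_norm univ_space U = onorm U"
  by (simp add: op_norm_def onorm_def)


section \<open>Unbounded operators\<close>

text \<open>Only the values of \<open>app\<close> on the domain are meaningful.\<close>

record 'v oper =
  domain :: "'v set"
  app :: "'v \<Rightarrow> 'v"

definition operator_on :: "'v cspace \<Rightarrow> 'v oper \<Rightarrow> bool" where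
  "operator_on V A \<longleftrightarrow>
     domain A \<subseteq> pts V \<and> app A ` domain A \<subseteq> pts V \<and>
     vzero V \<in> domain A \<and>
     (\<forall>x\<in>domain A. \<forall>y\<in>domain A.
        vadd V x y \<in> domain A \<and> app A (vadd V x y) = vadd V (app A x) (app A y)) \<and>
     (\<forall>a. \<forall>x\<in>domain A.
        vscale V a x \<in> domain A \<and> app A (vscale V a x) = vscale V a (app A x))"

definition op_inverse :: "'v oper \<Rightarrow> 'v \<Rightarrow> 'v" where
  "op_inverse A = inv_into (domain A) (app A)"

definition op_invertible :: "'v cspace \<Rightarrow> 'v oper \<Rightarrow> bool" where
  "op_invertible V A \<longleftrightarrow>
     bij_betw (app A) (domain A) (pts V) \<and> op_inverse A \<in> bounded_ops V"

text \<open>The operator \<open>\<lambda> - A\<close> with domain \<open>D(A)\<close>.\<close>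

definition shifted :: "'v cspace \<Rightarrow> complex \<Rightarrow> 'v oper \<Rightarrow> 'v oper" where
  "shifted V l A = \<lparr>domain = domain A, app = (\<lambda>x. vdiff V (vscale V l x) (app A x))\<rparr>"

definition resolvent_set :: "'v cspace \<Rightarrow> 'v oper \<Rightarrow> complex set" where
  "resolvent_set V A = {l. op_invertible V (shifted V l A)}"

definition op_spectrum :: "'v cspace \<Rightarrow> 'v oper \<Rightarrow> complex set" where
  "op_spectrum V A = - resolvent_set V A"

definition resolvent :: "'v cspace \<Rightarrow> complex \<Rightarrow> 'v oper \<Rightarrow> 'v \<Rightarrow> 'v" where
  "resolvent V l A = op_inverse (shifted V l A)"

definition commutant :: "'v cspace \<Rightarrow> 'v oper \<Rightarrow> ('v \<Rightarrow> 'v) set" where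
  "commutant V A = {U \<in> bounded_ops V.
     \<forall>x\<in>domain A. U x \<in> domain A \<and> app A (U x) = U (app A x)}"

text \<open>
  \<open>B\<close> on \<open>W\<close> is an outer extension of \<open>A\<close> on \<open>V\<close>, where \<open>V\<close> is identified with its image
  under the isometric embedding \<open>j\<close> of \<open>V\<close> into \<open>W\<close>.
\<close>

definition outer_extension ::
    "'v cspace \<Rightarrow> ('v \<Rightarrow> 'w) \<Rightarrow> 'v oper \<Rightarrow> 'w oper \<Rightarrow> bool" where
  "outer_extension V j A B \<longleftrightarrow>
     j ` domain A = domain B \<inter> j ` pts V \<and>
     (\<forall>x\<in>domain A. app B (j x) = j (app A x))"


section \<open>Semigroups and generators\<close>

definition C0_semigroup :: "'v cspace \<Rightarrow> (real \<Rightarrow> 'v \<Rightarrow> 'v) \<Rightarrow> bool" where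
  "C0_semigroup V T \<longleftrightarrow>
     (\<forall>t\<ge>0. T t \<in> bounded_ops V) \<and>
     (\<forall>x\<in>pts V. T 0 x = x) \<and>
     (\<forall>s\<ge>0. \<forall>t\<ge>0. \<forall>x\<in>pts V. T (s + t) x = T s (T t x)) \<and>
     (\<forall>x\<in>pts V. \<forall>t\<ge>0. ((\<lambda>s. vdist V (T s x) (T t x)) \<longlongrightarrow> 0) (at t within {0..}))"

text \<open>\<open>y\<close> is the limit of \<open>(T(t)x - x)/t\<close> as \<open>t\<close> decreases to \<open>0\<close>.\<close>

definition right_derivative_at_0 ::
    "'v cspace \<Rightarrow> (real \<Rightarrow> 'v \<Rightarrow> 'v) \<Rightarrow> 'v \<Rightarrow> 'v \<Rightarrow> bool" where
  "right_derivative_at_0 V T x y \<longleftrightarrow>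
     ((\<lambda>t. vdist V (vscale V (complex_of_real (1 / t)) (vdiff V (T t x) x)) y) \<longlongrightarrow> 0)
       (at_right 0)"

definition generator_of :: "'v cspace \<Rightarrow> (real \<Rightarrow> 'v \<Rightarrow> 'v) \<Rightarrow> 'v oper \<Rightarrow> bool" where
  "generator_of V T A \<longleftrightarrow>
     domain A = {x \<in> pts V. \<exists>y\<in>pts V. right_derivative_at_0 V T x y} \<and>
     (\<forall>x\<in>domain A. app A x \<in> pts V \<and> right_derivative_at_0 V T x (app A x))"

definition generates_C0_semigroup :: "'v cspace \<Rightarrow> 'v oper \<Rightarrow> bool" where
  "generates_C0_semigroup V A \<longleftrightarrow> (\<exists>T. C0_semigroup V T \<and> generator_of V T A)"


section \<open>Homomorphisms between algebras of bounded operators\<close>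

definition unital_isometric_hom ::
    "'v cspace \<Rightarrow> ('v \<Rightarrow> 'v) set \<Rightarrow> 'w cspace \<Rightarrow> (('v \<Rightarrow> 'v) \<Rightarrow> 'w \<Rightarrow> 'w) \<Rightarrow> bool" where
  "unital_isometric_hom V \<A> W \<phi> \<longleftrightarrow>
     \<phi> ` \<A> \<subseteq> bounded_ops W \<and>
     (\<forall>y\<in>pts W. \<phi> (\<lambda>x. x) y = y) \<and>
     (\<forall>S\<in>\<A>. \<forall>U\<in>\<A>. \<forall>y\<in>pts W. \<phi> (\<lambda>x. vadd V (S x) (U x)) y = vadd W (\<phi> S y) (\<phi> U y)) \<and>
     (\<forall>a. \<forall>U\<in>\<A>. \<forall>y\<in>pts W. \<phi> (\<lambda>x. vscale V a (U x)) y = vscale W a (\<phi> U y)) \<and>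
     (\<forall>S\<in>\<A>. \<forall>U\<in>\<A>. \<forall>y\<in>pts W. \<phi> (\<lambda>x. S (U x)) y = \<phi> S (\<phi> U y)) \<and>
     (\<forall>U\<in>\<A>. op_norm W (\<phi> U) = op_norm V U)"

end

theory Submission
  imports Defs
begin

text \<open>
  If \<open>A\<close> is to acquire an inverse of norm at most \<open>1 / c\<close>, adjoin it freely: let \<open>z\<close> be a symbol of
  norm \<open>1 / c\<close> and consider the power series \<open>f = \<Sum> x\<^sub>n z\<^sup>n\<close> with coefficients in \<open>X\<close> and finite
  \<open>\<Sum> c\<^sup>-\<^sup>n \<parallel>x\<^sub>n\<parallel>\<close>. The space \<open>Y\<close> is their quotient by the closure of the relations \<open>g - z A g\<close>, which
  force \<open>z\<close> to act as \<open>A\<^sup>-\<^sup>1\<close>. (In the formal text the coefficients are rescaled, so that the sequence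
  space is plain \<open>\<ell>\<^sup>1\<close> and the shift is divided by \<open>c\<close>.)

  The lower bound on \<open>A\<close> enters once, to show that \<open>X\<close> embeds isometrically as the constant series:
  \<open>\<parallel>x - (g - z A g)\<parallel> \<ge> \<parallel>x + z A g\<parallel> - \<parallel>g\<parallel> = \<parallel>x\<parallel> + \<parallel>A g\<parallel> / c - \<parallel>g\<parallel> \<ge> \<parallel>x\<parallel>\<close>
  (\<open>infdist_single\<close>). Operators in the commutant of \<open>A\<close> act on coefficients, preserve the relations and
  hence act on \<open>Y\<close>; this is the homomorphism, and it is isometric because it extends operators on \<open>X\<close>.
  In particular the semigroup \<open>T\<close> lifts to \<open>Y\<close>. Its strong continuity follows by dominated convergence
  of the coefficient sums, the domination being provided by local boundedness of \<open>T\<close>.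

  Let \<open>S\<close> be multiplication by \<open>z\<close> on \<open>Y\<close>. The core of the proof is that the lifted semigroup is
  differentiable at \<open>S u\<close> with derivative \<open>u\<close> for every \<open>u\<close> in \<open>Y\<close> (\<open>right_derivative_inverse_op\<close>). With
  \<open>V\<^sub>t x = (1 / t) \<integral>\<^sub>0\<^sup>t T s x ds\<close> one has \<open>A V\<^sub>t x = (T t x - x) / t\<close> for all \<open>x\<close> in \<open>X\<close>, so the
  relations turn \<open>z (T t f - f) / t = z A V\<^sub>t f\<close> into \<open>V\<^sub>t f\<close>, which tends to \<open>f\<close>. Since derivatives
  are unique, \<open>S\<close> is injective and \<open>B = S\<^sup>-\<^sup>1\<close> is a restriction of the generator; it is all of it because
  \<open>S\<close> commutes with the semigroup.

  The remaining properties are now short. That \<open>B\<close> is an outer extension uses that the image of \<open>X\<close> is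
  closed, so that a derivative of an orbit in \<open>X\<close> lies in \<open>X\<close>. The lifted resolvent of \<open>A\<close> is a right
  inverse of \<open>\<lambda> - B\<close> by the relations, and a left inverse because it commutes with \<open>S\<close>.
\<close>

section \<open>Complex linearity and bounded operators\<close>

lemma scaleC_of_real_left [simp]: "complex_of_real r *\<^sub>C x = r *\<^sub>R (x::'a::cbanach)"
  by (rule scaleC_of_real)

lemma scaleC_one [simp]: "1 *\<^sub>C x = (x::'a::cbanach)"
  using scaleC_of_real[of 1 x] by simp

lemma scaleC_minus_one: "(-1) *\<^sub>C x = - (x::'a::cbanach)"
  using scaleC_of_real[of "-1" x] by simp

lemma bounded_linear_scaleC: "bounded_linear (\<lambda>x::'a::cbanach. a *\<^sub>C x)"
proof
  show "a *\<^sub>C (r *\<^sub>R x) = r *\<^sub>R (a *\<^sub>C x)" for r and x :: 'a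
    by (metis mult.commute scaleC_of_real scaleC_scaleC)
  show "\<exists>K. \<forall>x::'a. norm (a *\<^sub>C x) \<le> norm x * K"
    by (metis mult.commute norm_scaleC order_refl)
qed (rule scaleC_add_right)

lemmas scaleC_scaleR = linear_scale[OF bounded_linear.linear[OF bounded_linear_scaleC]]
lemmas scaleC_zero_right [simp] = linear_0[OF bounded_linear.linear[OF bounded_linear_scaleC]]
lemmas scaleC_diff_right = linear_diff[OF bounded_linear.linear[OF bounded_linear_scaleC]]

lemma bounded_ops_univ_space:
  "U \<in> bounded_ops univ_space \<longleftrightarrow>
     bounded_linear U \<and> (\<forall>a x. U (a *\<^sub>C x) = a *\<^sub>C U (x::'a::cbanach))"
proof
  assume U: "U \<in> bounded_ops univ_space"
  then obtain K where K: "\<And>x. norm (U x) \<le> K * norm x"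
    by (auto simp: bounded_ops_def)
  have "U (r *\<^sub>R x) = r *\<^sub>R U x" for r x
    using U by (simp add: bounded_ops_def flip: scaleC_of_real_left)
  then have "bounded_linear U"
    using U K by (intro bounded_linear_intro[where K = K]) (auto simp: bounded_ops_def mult.commute)
  with U show "bounded_linear U \<and> (\<forall>a x. U (a *\<^sub>C x) = a *\<^sub>C U x)"
    by (auto simp: bounded_ops_def)
next
  assume "bounded_linear U \<and> (\<forall>a x. U (a *\<^sub>C x) = a *\<^sub>C U x)"
  then show "U \<in> bounded_ops univ_space"
    unfolding bounded_ops_def
    by (auto simp: linear_add[OF bounded_linear.linear] intro!: exI[of _ "onorm U"] onorm)
qed

lemma bounded_ops_univ_spaceD:
  assumes "U \<in> bounded_ops univ_space"
  shows "bounded_linear U" "U (x + y) = U x + U y" "U (x - y) = U x - U y"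
    "U (a *\<^sub>C x) = a *\<^sub>C U (x::'a::cbanach)" "U (r *\<^sub>R x) = r *\<^sub>R U x" "U 0 = 0"
proof -
  show U: "bounded_linear U" "U (a *\<^sub>C x) = a *\<^sub>C U x"
    using assms by (auto simp: bounded_ops_univ_space)
  show "U (x + y) = U x + U y" "U (x - y) = U x - U y" "U (r *\<^sub>R x) = r *\<^sub>R U x" "U 0 = 0"
    using U(1) by (auto simp: linear_add linear_diff linear_scale linear_0 bounded_linear.linear)
qed


section \<open>The uniform boundedness principle\<close>

text \<open>
  The sets of points at which all operators are bounded by \<open>n\<close> are closed and cover the space,
  so by Baire one of them contains a ball; differences of points of that ball with its centre
  are the multiples of all vectors.
\<close>

lemma uniform_boundedness:
  fixes F :: "'i \<Rightarrow> 'a::banach \<Rightarrow> 'b::real_normed_vector"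
  assumes lin: "\<And>i. i \<in> I \<Longrightarrow> bounded_linear (F i)"
    and pointwise: "\<And>x. \<exists>K. \<forall>i\<in>I. norm (F i x) \<le> K"
  shows "\<exists>M. \<forall>i\<in>I. \<forall>x. norm (F i x) \<le> M * norm x"
proof -
  define C where "C n = {x. \<forall>i\<in>I. norm (F i x) \<le> real n}" for n
  have C_eq: "C n = (\<Inter>i\<in>I. {x. norm (F i x) \<le> real n})" for n
    by (auto simp: C_def)
  have closed: "closed (C n)" for n
    unfolding C_eq
    by (intro closed_INT ballI closed_Collect_le continuous_intros
        linear_continuous_on[OF lin])
  have "(\<Union>n. C n) = UNIV"
  proof -
    have "\<exists>n. x \<in> C n" for x
    proof -
      obtain K where "\<forall>i\<in>I. norm (F i x) \<le> K"
        using pointwise by blast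
      moreover obtain n where "K \<le> real n"
        using real_arch_simple by blast
      ultimately show ?thesis
        by (auto simp: C_def intro: order_trans)
    qed
    then show ?thesis by auto
  qed
  then have "euclidean interior_of (\<Union>(range C)) \<noteq> {}"
    by simp
  then obtain n where n: "interior (C n) \<noteq> {}"
    using Baire_category_alt[of "euclidean :: 'a topology" "range C"] closed
      completely_metrizable_space_euclidean
    by (auto simp: image_iff)
  then obtain x0 r where r: "r > 0" and ball: "cball x0 r \<subseteq> C n"
    by (metis ex_in_conv mem_interior_cball)
  have "norm (F i x) \<le> (2 * real n / r) * norm x" if "i \<in> I" for i x
  proof (cases "x = 0")
    case True
    with lin[OF that] show ?thesis
      by (simp add: linear_0 bounded_linear.linear)
  next
    case False
    interpret F: bounded_linear "F i" by (rule lin[OF that])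
    define y where "y = (r / norm x) *\<^sub>R x"
    have "x0 + y \<in> cball x0 r" "x0 \<in> cball x0 r"
      using r False by (auto simp: y_def dist_norm)
    then have "x0 + y \<in> C n" "x0 \<in> C n"
      using ball by blast+
    with that have *: "norm (F i (x0 + y)) \<le> real n" "norm (F i x0) \<le> real n"
      by (auto simp: C_def)
    have "norm (F i y) = norm (F i (x0 + y) - F i x0)"
      by (simp add: F.add)
    also have "\<dots> \<le> real n + real n"
      using * norm_triangle_ineq4[of "F i (x0 + y)" "F i x0"] by linarith
    finally have "r / norm x * norm (F i x) \<le> 2 * real n"
      using r by (simp add: y_def F.scaleR)
    then show ?thesis
      using r False by (simp add: field_simps)
  qed
  then show ?thesis by blast
qed


section \<open>Absolutely summable sequences\<close>

typedef (overloaded) 'a ell1 = "{f :: nat \<Rightarrow> 'a::real_normed_vector. summable (\<lambda>n. norm (f n))}"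
  morphisms coeff Ell1
  by (rule exI[of _ "\<lambda>_. 0"]) simp

setup_lifting type_definition_ell1

lemma summable_norm_coeff: "summable (\<lambda>n. norm (coeff f n))"
  using coeff[of f] by simp

lemma ell1_eqI: "(\<And>n. coeff f n = coeff g n) \<Longrightarrow> f = g"
  by (metis coeff_inject ext)

instantiation ell1 :: (real_normed_vector) real_normed_vector
begin

lift_definition zero_ell1 :: "'a ell1" is "\<lambda>_. 0" by simp

lift_definition plus_ell1 :: "'a ell1 \<Rightarrow> 'a ell1 \<Rightarrow> 'a ell1" is "\<lambda>f g n. f n + g n"
  by (rule summable_comparison_test'[OF summable_add, where N = 0])
    (assumption | simp add: norm_triangle_ineq)+

lift_definition uminus_ell1 :: "'a ell1 \<Rightarrow> 'a ell1" is "\<lambda>f n. - f n"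
  by simp

lift_definition minus_ell1 :: "'a ell1 \<Rightarrow> 'a ell1 \<Rightarrow> 'a ell1" is "\<lambda>f g n. f n - g n"
  by (rule summable_comparison_test'[OF summable_add, where N = 0])
    (assumption | simp add: norm_triangle_ineq4)+

lift_definition scaleR_ell1 :: "real \<Rightarrow> 'a ell1 \<Rightarrow> 'a ell1" is "\<lambda>r f n. r *\<^sub>R f n"
  by (simp add: summable_mult)

definition norm_ell1 :: "'a ell1 \<Rightarrow> real" where
  "norm_ell1 f = (\<Sum>n. norm (coeff f n))"

definition sgn_ell1 :: "'a ell1 \<Rightarrow> 'a ell1" where
  "sgn_ell1 f = inverse (norm f) *\<^sub>R f"

definition dist_ell1 :: "'a ell1 \<Rightarrow> 'a ell1 \<Rightarrow> real" where
  "dist_ell1 f g = norm (f - g)"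

definition uniformity_ell1 :: "('a ell1 \<times> 'a ell1) filter" where
  "uniformity_ell1 = (INF e\<in>{0 <..}. principal {(f, g). dist f g < e})"

definition open_ell1 :: "'a ell1 set \<Rightarrow> bool" where
  "open_ell1 S = (\<forall>f\<in>S. \<forall>\<^sub>F (f', g) in uniformity. f' = f \<longrightarrow> g \<in> S)"

instance
proof
  fix f g :: "'a ell1" and r :: real
  show "(norm f = 0) = (f = 0)"
  proof
    assume "norm f = 0"
    then have "\<forall>n. norm (coeff f n) = 0"
      using suminf_eq_zero_iff[OF summable_norm_coeff] by (auto simp: norm_ell1_def)
    then show "f = 0"
      by (intro ell1_eqI) (simp add: zero_ell1.rep_eq)
  qed (simp add: norm_ell1_def zero_ell1.rep_eq)
  show "norm (f + g) \<le> norm f + norm g"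
    unfolding norm_ell1_def suminf_add[OF summable_norm_coeff summable_norm_coeff]
    by (intro suminf_le summable_add summable_norm_coeff)
      (simp add: plus_ell1.rep_eq norm_triangle_ineq)
  show "norm (r *\<^sub>R f) = \<bar>r\<bar> * norm f"
    by (simp add: norm_ell1_def scaleR_ell1.rep_eq suminf_mult summable_norm_coeff)
qed (auto simp: sgn_ell1_def dist_ell1_def uniformity_ell1_def open_ell1_def
    intro!: ell1_eqI simp: plus_ell1.rep_eq minus_ell1.rep_eq uminus_ell1.rep_eq zero_ell1.rep_eq
    scaleR_ell1.rep_eq algebra_simps)

end

lemmas coeff_simps [simp] =
  plus_ell1.rep_eq minus_ell1.rep_eq uminus_ell1.rep_eq zero_ell1.rep_eq scaleR_ell1.rep_eq

lemma norm_coeff_le: "norm (coeff f n) \<le> norm f"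
  unfolding norm_ell1_def
  using sum_le_suminf[OF summable_norm_coeff[of f], of "{n}"] by simp

lemma bounded_linear_coeff: "bounded_linear (\<lambda>f. coeff f n)"
  by (rule bounded_linear_intro[where K = 1]) (auto simp: norm_coeff_le)

text \<open>
  Coefficientwise limits of a Cauchy sequence inherit every bound on partial sums, hence the limit
  is summable and is attained in norm.
\<close>

instance ell1 :: (banach) banach
proof
  fix F :: "nat \<Rightarrow> 'a ell1"
  assume cauchy: "Cauchy F"
  define l where "l n = lim (\<lambda>k. coeff (F k) n)" for n
  have lim: "(\<lambda>k. coeff (F k) n) \<longlonglongrightarrow> l n" for n
    unfolding l_def
    using bounded_linear.Cauchy[OF bounded_linear_coeff cauchy]
    by (simp add: Cauchy_convergent convergent_LIMSEQ_iff[symmetric])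
  have tail: "\<exists>K. \<forall>k\<ge>K. summable (\<lambda>n. norm (coeff (F k) n - l n)) \<and>
      (\<Sum>n. norm (coeff (F k) n - l n)) \<le> e" if "e > 0" for e
  proof -
    obtain K where K: "\<And>k m. k \<ge> K \<Longrightarrow> m \<ge> K \<Longrightarrow> norm (F k - F m) < e"
      using cauchy \<open>e > 0\<close> unfolding Cauchy_iff by metis
    have "(\<Sum>n<N. norm (coeff (F k) n - l n)) \<le> e" if "k \<ge> K" for k N
    proof (rule tendsto_upperbound)
      show "(\<lambda>m. \<Sum>n<N. norm (coeff (F k) n - coeff (F m) n))
          \<longlonglongrightarrow> (\<Sum>n<N. norm (coeff (F k) n - l n))"
        by (intro tendsto_intros lim)
      have "(\<Sum>n<N. norm (coeff (F k) n - coeff (F m) n)) \<le> e" if "m \<ge> K" for m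
      proof -
        have "(\<Sum>n<N. norm (coeff (F k) n - coeff (F m) n)) \<le> norm (F k - F m)"
          unfolding norm_ell1_def
          using sum_le_suminf[OF summable_norm_coeff[of "F k - F m"], of "{..<N}"] by simp
        with K[OF \<open>k \<ge> K\<close> that] show ?thesis by linarith
      qed
      then show "\<forall>\<^sub>F m in sequentially. (\<Sum>n<N. norm (coeff (F k) n - coeff (F m) n)) \<le> e"
        by (auto simp: eventually_sequentially)
    qed simp
    then have "summable (\<lambda>n. norm (coeff (F k) n - l n)) \<and>
        (\<Sum>n. norm (coeff (F k) n - l n)) \<le> e" if "k \<ge> K" for k
      using that by (auto intro!: summableI_nonneg_bounded suminf_le_const)
    then show ?thesis by blast
  qed
  obtain K where K: "summable (\<lambda>n. norm (coeff (F K) n - l n))"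
    using tail[of 1] by auto
  have "summable (\<lambda>n. norm (l n))"
  proof (rule summable_comparison_test'[OF summable_add[OF K summable_norm_coeff[of "F K"]]])
    show "norm (norm (l n)) \<le> norm (coeff (F K) n - l n) + norm (coeff (F K) n)" for n
      using norm_triangle_sub[of "l n" "coeff (F K) n"] by (simp add: norm_minus_commute)
  qed
  then have l: "coeff (Ell1 l) = l"
    by (simp add: Ell1_inverse)
  have "F \<longlonglongrightarrow> Ell1 l"
  proof (rule LIMSEQ_I)
    fix e :: real
    assume "e > 0"
    then obtain K where "\<forall>k\<ge>K. (\<Sum>n. norm (coeff (F k) n - l n)) \<le> e / 2"
      using tail[of "e / 2"] by auto
    then show "\<exists>K. \<forall>k\<ge>K. norm (F k - Ell1 l) < e"
      using \<open>e > 0\<close> by (intro exI[of _ K]) (auto simp: norm_ell1_def l)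
  qed
  then show "convergent F"
    by (auto simp: convergent_def)
qed

instantiation ell1 :: (cbanach) cbanach
begin

lift_definition scaleC_ell1 :: "complex \<Rightarrow> 'a ell1 \<Rightarrow> 'a ell1" is "\<lambda>a f n. a *\<^sub>C f n"
  by (simp add: norm_scaleC summable_mult)

instance
  by standard
    (auto intro!: ell1_eqI simp: scaleC_ell1.rep_eq scaleC_add_right scaleC_add_left scaleC_scaleC
      norm_ell1_def norm_scaleC suminf_mult summable_norm_coeff)

end

lemmas coeff_scaleC [simp] = scaleC_ell1.rep_eq

text \<open>The default \<open>0\<close> for unbounded \<open>U\<close> makes the image sequence summable without a side condition.\<close>

lift_definition ell1_map ::
    "('a::real_normed_vector \<Rightarrow> 'b::real_normed_vector) \<Rightarrow> 'a ell1 \<Rightarrow> 'b ell1"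
  is "\<lambda>U f n. if bounded_linear U then U (f n) else 0"
proof -
  fix U :: "'a \<Rightarrow> 'b" and f :: "nat \<Rightarrow> 'a"
  assume f: "summable (\<lambda>n. norm (f n))"
  show "summable (\<lambda>n. norm (if bounded_linear U then U (f n) else 0))"
    by (cases "bounded_linear U")
      (auto intro!: summable_comparison_test'[OF summable_mult[OF f, of "onorm U"]] onorm)
qed

lemma coeff_ell1_map: "bounded_linear U \<Longrightarrow> coeff (ell1_map U f) n = U (coeff f n)"
  by (simp add: ell1_map.rep_eq)

lemma norm_ell1_map_le:
  assumes "bounded_linear U" and "\<And>x. norm (U x) \<le> K * norm x"
  shows "norm (ell1_map U f) \<le> K * norm f"
  unfolding norm_ell1_def suminf_mult[OF summable_norm_coeff, symmetric]
  by (intro suminf_le summable_mult summable_norm_coeff) (simp add: assms coeff_ell1_map)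

lemma ell1_map_bounded_ops:
  assumes "U \<in> bounded_ops univ_space"
  shows "ell1_map U \<in> bounded_ops univ_space"
proof -
  note U = bounded_ops_univ_spaceD[OF assms]
  have "norm (ell1_map U f) \<le> onorm U * norm f" for f
    by (intro norm_ell1_map_le U onorm)
  then show ?thesis
    unfolding bounded_ops_def
    by (auto intro!: ell1_eqI simp: coeff_ell1_map U)
qed

text \<open>
  Strong convergence of operators that are uniformly bounded passes to sequences: the
  coefficientwise errors are dominated by a summable sequence.
\<close>

lemma tendsto_ell1_map:
  fixes U :: "'i \<Rightarrow> 'a::real_normed_vector \<Rightarrow> 'a"
  assumes lin: "\<forall>\<^sub>F i in F. bounded_linear (U i)"
    and bound: "\<forall>\<^sub>F i in F. \<forall>x. norm (U i x) \<le> K * norm x"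
    and lim: "\<And>x. ((\<lambda>i. U i x) \<longlongrightarrow> W x) F" and W: "bounded_linear W"
  shows "((\<lambda>i. ell1_map (U i) f) \<longlongrightarrow> ell1_map W f) F"
proof (cases "F = bot")
  case False
  define M where "M n = K * norm (coeff f n) + norm (W (coeff f n))" for n
  have "summable (\<lambda>n. norm (W (coeff f n)))"
    using summable_norm_coeff[of "ell1_map W f"] by (simp add: coeff_ell1_map W)
  then have M: "summable M"
    unfolding M_def by (intro summable_add summable_mult summable_norm_coeff)
  have "\<forall>\<^sub>F i in F. \<forall>n. norm (norm (U i (coeff f n) - W (coeff f n))) \<le> M n"
    using bound
  proof eventually_elim
    case (elim i)
    show ?case
      unfolding M_def real_norm_def abs_norm_cancel
      using elim norm_triangle_ineq4 add_right_mono order_trans by metis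
  qed
  then have "\<forall>\<^sub>F (n, i) in sequentially \<times>\<^sub>F F.
      norm (norm (U i (coeff f n) - W (coeff f n))) \<le> M n"
    unfolding eventually_prod_filter
    by (intro exI[of _ "\<lambda>_::nat. True"]
        exI[of _ "\<lambda>i. \<forall>n. norm (norm (U i (coeff f n) - W (coeff f n))) \<le> M n"])
      (simp del: real_norm_def)
  then have "((\<lambda>i. \<Sum>n. norm (U i (coeff f n) - W (coeff f n))) \<longlongrightarrow> (\<Sum>n::nat. 0)) F"
    using False M
    by (intro tannerys_theorem[where M = M, THEN conjunct2, THEN conjunct2])
      (auto intro!: tendsto_norm_zero LIM_zero lim)
  then have "((\<lambda>i. \<Sum>n. norm (U i (coeff f n) - W (coeff f n))) \<longlongrightarrow> 0) F"
    by simp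
  moreover have "\<forall>\<^sub>F i in F. (\<Sum>n. norm (U i (coeff f n) - W (coeff f n))) =
      norm (ell1_map (U i) f - ell1_map W f)"
    using lin by eventually_elim (simp add: norm_ell1_def coeff_ell1_map W)
  ultimately have "((\<lambda>i. norm (ell1_map (U i) f - ell1_map W f)) \<longlongrightarrow> 0) F"
    by (rule Lim_transform_eventually)
  then show ?thesis
    by (rule LIM_zero_cancel[OF tendsto_norm_zero_cancel])
qed simp

lift_definition single :: "'a::real_normed_vector \<Rightarrow> 'a ell1"
  is "\<lambda>x (n::nat). if n = 0 then x else 0"
  by (rule summable_finite[of "{0}"]) auto

lift_definition push :: "'a::real_normed_vector ell1 \<Rightarrow> 'a ell1"
  is "\<lambda>f (n::nat). if n = 0 then 0 else f (n - 1)"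
  by (subst summable_Suc_iff[symmetric]) simp

lemma coeff_single: "coeff (single x) n = (if n = 0 then x else 0)"
  by (simp add: single.rep_eq)

lemma coeff_push: "coeff (push f) n = (if n = 0 then 0 else coeff f (n - 1))"
  by (simp add: push.rep_eq)

lemma norm_single_push: "norm (single x + push f) = norm x + norm f"
  unfolding norm_ell1_def
  using suminf_split_head[OF summable_norm_coeff[of "single x + push f"]]
  by (simp add: coeff_single coeff_push)

lemma norm_single: "norm (single x) = norm x"
proof -
  have "push 0 = (0 :: 'a ell1)"
    by (intro ell1_eqI) (simp add: coeff_push)
  with norm_single_push[of x 0] show ?thesis by simp
qed

lemma norm_push: "norm (push f) = norm f"
proof -
  have "single 0 = (0 :: 'a ell1)"
    by (intro ell1_eqI) (simp add: coeff_single)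
  with norm_single_push[of 0 f] show ?thesis by simp
qed


section \<open>Bounded inverses and quotients of Banach spaces\<close>

lemma op_norm_le:
  assumes "vzero V \<in> pts V"
    and "\<And>x. x \<in> pts V \<Longrightarrow> 0 \<le> vnorm V x"
    and "0 \<le> K" and "\<And>x. x \<in> pts V \<Longrightarrow> vnorm V (L x) \<le> K * vnorm V x"
  shows "op_norm V L \<le> K"
  unfolding op_norm_def
proof (rule cSUP_least)
  show "vnorm V (L x) / vnorm V x \<le> K" if "x \<in> pts V" for x
    using assms(2,4)[OF that] \<open>0 \<le> K\<close> by (cases "vnorm V x = 0") (auto simp: field_simps)
qed (use assms(1) in blast)

text \<open>A bounded two-sided inverse identifies the inverse operator, which is a choice function.\<close>

lemma op_invertibleI:
  assumes L: "L \<in> bounded_ops V" and ran: "L ` pts V \<subseteq> domain A"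
    and app: "app A ` domain A \<subseteq> pts V"
    and right: "\<And>y. y \<in> pts V \<Longrightarrow> app A (L y) = y"
    and left: "\<And>x. x \<in> domain A \<Longrightarrow> L (app A x) = x"
    and V: "complex_banach_space V"
  shows "op_invertible V A" and "\<And>y. y \<in> pts V \<Longrightarrow> op_inverse A y = L y"
proof -
  interpret complex_banach_space V by (rule V)
  have bij: "bij_betw (app A) (domain A) (pts V)"
    by (rule bij_betw_byWitness[where f' = L]) (use assms in auto)
  show eq: "op_inverse A y = L y" if "y \<in> pts V" for y
    unfolding op_inverse_def
    using bij that ran right by (intro inv_into_f_eq) (auto simp: bij_betw_def)
  have "op_inverse A \<in> bounded_ops V"
    using L by (auto simp: bounded_ops_def eq add_closed scale_closed)
  with bij show "op_invertible V A"
    by (simp add: op_invertible_def)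
qed

text \<open>
  The quotient of \<open>'e\<close> by a closed subspace \<open>M\<close>. The cosets are named by an arbitrary map \<open>q\<close>
  whose fibres they are, so that they can be placed in a type that does not mention \<open>'e\<close>.
\<close>

locale banach_quotient =
  fixes M :: "'e::cbanach set" and q :: "'e \<Rightarrow> 'w"
  assumes closed_M: "closed M" and zero_M: "0 \<in> M"
    and add_M: "\<lbrakk>x \<in> M; y \<in> M\<rbrakk> \<Longrightarrow> x + y \<in> M"
    and scaleC_M: "x \<in> M \<Longrightarrow> a *\<^sub>C x \<in> M"
    and q_eq_iff: "q x = q y \<longleftrightarrow> x - y \<in> M"
begin

definition rep :: "'w \<Rightarrow> 'e" where
  "rep = inv q"

definition Quot :: "'w cspace" where
  "Quot = \<lparr>pts = range q, vzero = q 0, vadd = (\<lambda>u v. q (rep u + rep v)),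
     vscale = (\<lambda>a u. q (a *\<^sub>C rep u)), vnorm = (\<lambda>u. infdist (rep u) M)\<rparr>"

text \<open>Meaningful for maps that preserve \<open>M\<close>, as the choice of representatives is then immaterial.\<close>

definition induced :: "('e \<Rightarrow> 'e) \<Rightarrow> 'w \<Rightarrow> 'w" where
  "induced L u = q (L (rep u))"

lemma minus_M: "x \<in> M \<Longrightarrow> - x \<in> M"
  using scaleC_M[of x "-1"] by (simp add: scaleC_minus_one)

lemma q_rep: "u \<in> range q \<Longrightarrow> q (rep u) = u"
  by (simp add: rep_def f_inv_into_f)

lemma rep_q: "rep (q x) - x \<in> M"
  using q_rep[of "q x"] q_eq_iff[of "rep (q x)" x] by blast

lemma q_cong: "x - y \<in> M \<Longrightarrow> q x = q y"
  by (simp add: q_eq_iff)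

lemma infdist_diff_le:
  assumes "y - x \<in> M"
  shows "infdist x M \<le> infdist y M"
  unfolding infdist_notempty[of M y, OF ex_in_conv[THEN iffD1, OF exI, OF zero_M]]
proof (rule cINF_greatest)
  show "infdist x M \<le> dist y a" if "a \<in> M" for a
  proof (rule infdist_le2)
    show "a - (y - x) \<in> M"
      using add_M[OF that minus_M[OF assms]] by (simp add: algebra_simps)
  qed (simp add: dist_norm algebra_simps)
qed (use zero_M in auto)

lemma infdist_cong: "y - x \<in> M \<Longrightarrow> infdist x M = infdist y M"
  using minus_M[of "y - x"] by (intro antisym infdist_diff_le) auto

lemma infdist_rep: "infdist (rep (q x)) M = infdist x M"
  using infdist_cong[OF rep_q] by simp

lemma vadd_q: "vadd Quot (q x) (q y) = q (x + y)"
  using add_M[OF rep_q[of x] rep_q[of y]]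
  by (auto simp: Quot_def intro!: q_cong) (simp add: algebra_simps)

lemma vscale_q: "vscale Quot a (q x) = q (a *\<^sub>C x)"
  using scaleC_M[OF rep_q[of x], of a]
  by (auto simp: Quot_def scaleC_diff_right intro!: q_cong)

lemma Quot_simps [simp]:
  "pts Quot = range q" "vzero Quot = q 0"
  "vadd Quot (q x) (q y) = q (x + y)" "vscale Quot a (q x) = q (a *\<^sub>C x)"
  "vnorm Quot (q x) = infdist x M"
  by (simp_all add: vadd_q vscale_q) (simp_all add: Quot_def infdist_rep)

lemma q_pts: "q x \<in> pts Quot"
  by simp

lemma vdiff_q [simp]: "vdiff Quot (q x) (q y) = q (x - y)"
  by (simp add: vdiff_def scaleC_minus_one)

lemma vdist_q [simp]: "vdist Quot (q x) (q y) = infdist (x - y) M"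
  by (simp add: vdist_def)

lemma infdist_le_norm: "infdist x M \<le> norm x"
  using infdist_le[OF zero_M, of x] by (simp add: dist_norm)

lemma infdist_eq_0_iff: "infdist x M = 0 \<longleftrightarrow> x \<in> M"
  using in_closed_iff_infdist_zero[OF closed_M] zero_M by blast

lemma infdist_less_iff: "infdist x M < e \<longleftrightarrow> (\<exists>a\<in>M. norm (x - a) < e)"
proof -
  have "M \<noteq> {}" using zero_M by blast
  then show ?thesis
    by (simp add: infdist_notempty dist_norm cINF_less_iff bdd_belowI2[of _ 0])
qed

text \<open>
  An element of \<open>M\<close> almost nearest to \<open>x\<close> is mapped into \<open>M\<close>, to one comparably near to \<open>L x\<close>; so
  the operator induced on the quotient is no larger than \<open>L\<close>.
\<close>

lemma infdist_image_le:
  assumes L: "L \<in> bounded_ops univ_space" and M: "L ` M \<subseteq> M"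
    and K: "\<And>x. norm (L x) \<le> K * norm x" and "0 \<le> K"
  shows "infdist (L x) M \<le> K * infdist x M"
proof (rule field_le_epsilon)
  fix e :: real
  assume e: "e > 0"
  have "infdist x M < infdist x M + e / (K + 1)"
    using e \<open>0 \<le> K\<close> by simp
  then obtain a where a: "a \<in> M" "norm (x - a) < infdist x M + e / (K + 1)"
    using infdist_less_iff by blast
  have "infdist (L x) M \<le> norm (L (x - a))"
    using M a(1)
    by (intro infdist_le2[of "L a"]) (auto simp: dist_norm bounded_ops_univ_spaceD(3)[OF L])
  also have "\<dots> \<le> K * (infdist x M + e / (K + 1))"
    using K[of "x - a"] mult_left_mono[OF less_imp_le[OF a(2)] \<open>0 \<le> K\<close>] by linarith
  also have "\<dots> \<le> K * infdist x M + e"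
    using e \<open>0 \<le> K\<close> by (simp add: field_simps)
  finally show "infdist (L x) M \<le> K * infdist x M + e" .
qed

lemma infdist_add_le: "infdist (x + y) M \<le> infdist x M + infdist y M"
proof (rule field_le_epsilon)
  fix e :: real
  assume "e > 0"
  then have "infdist x M < infdist x M + e / 2" "infdist y M < infdist y M + e / 2"
    by auto
  then obtain a b where ab: "a \<in> M" "norm (x - a) < infdist x M + e / 2"
      "b \<in> M" "norm (y - b) < infdist y M + e / 2"
    using infdist_less_iff by metis
  have "infdist (x + y) M \<le> norm ((x - a) + (y - b))"
    by (rule infdist_le2[OF add_M[OF ab(1,3)]]) (simp add: dist_norm algebra_simps)
  with ab norm_triangle_ineq[of "x - a" "y - b"]
  show "infdist (x + y) M \<le> infdist x M + infdist y M + e"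
    by simp
qed

lemma infdist_scaleC: "infdist (a *\<^sub>C x) M = cmod a * infdist x M"
proof -
  have *: "infdist (b *\<^sub>C y) M \<le> cmod b * infdist y M" for b y
    using scaleC_M
    by (intro infdist_image_le)
      (auto simp: bounded_ops_univ_space bounded_linear_scaleC scaleC_scaleC norm_scaleC mult.commute)
  show ?thesis
  proof (cases "a = 0")
    case True
    then show ?thesis
      using scaleC_of_real[of 0 x] by (simp add: zero_M)
  next
    case False
    have "cmod a * infdist x M \<le> cmod a * (cmod (inverse a) * infdist (a *\<^sub>C x) M)"
      using *[of "inverse a" "a *\<^sub>C x"] False
      by (intro mult_left_mono) (simp_all add: scaleC_scaleC)
    also have "\<dots> = infdist (a *\<^sub>C x) M"
      using False by (simp add: norm_inverse)
    finally show ?thesis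
      using * by (intro antisym)
  qed
qed

sublocale Quot_metric: Metric_space "pts Quot" "vdist Quot"
proof
  show "0 \<le> vdist Quot u v" for u v
    by (simp add: vdist_def Quot_def infdist_nonneg)
  show "vdist Quot u v = vdist Quot v u" for u v
  proof -
    have "infdist (x - y) M \<le> infdist (y - x) M" for x y
      using infdist_scaleC[of "-1" "y - x"] by (simp add: scaleC_minus_one)
    then have "infdist (rep u - rep v) M = infdist (rep v - rep u) M"
      by (intro antisym)
    moreover have "vdist Quot u v = infdist (rep u - rep v) M" for u v
    proof -
      have "vdist Quot u v = infdist (rep u + rep (q (- rep v))) M"
        by (simp add: vdist_def vdiff_def Quot_def infdist_rep scaleC_minus_one)
      also have "\<dots> = infdist (rep u - rep v) M"
        using rep_q[of "- rep v"]
        by (intro infdist_cong[symmetric]) (simp add: algebra_simps)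
      finally show ?thesis .
    qed
    ultimately show ?thesis by simp
  qed
  show "(vdist Quot u v = 0) = (u = v)" if "u \<in> pts Quot" "v \<in> pts Quot" for u v
    using that by (auto simp: infdist_eq_0_iff q_eq_iff)
  show "vdist Quot u w \<le> vdist Quot u v + vdist Quot v w"
    if "u \<in> pts Quot" "v \<in> pts Quot" "w \<in> pts Quot" for u v w
  proof -
    obtain x y z where "u = q x" "v = q y" "w = q z"
      using \<open>u \<in> pts Quot\<close> \<open>v \<in> pts Quot\<close> \<open>w \<in> pts Quot\<close> by auto
    then show ?thesis
      using infdist_add_le[of "x - y" "y - z"] by simp
  qed
qed

text \<open>
  From a Cauchy sequence of cosets one extracts a rapidly converging subsequence. Its terms have
  representatives whose successive differences are summable, and these converge.
\<close>

lemma mcomplete_Quot: "Metric_space.mcomplete (pts Quot) (vdist Quot)"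
  unfolding Quot_metric.mcomplete_def
proof (intro allI impI)
  fix \<sigma> :: "nat \<Rightarrow> 'w"
  assume \<sigma>: "Quot_metric.MCauchy \<sigma>"
  then have "range \<sigma> \<subseteq> pts Quot"
    unfolding Quot_metric.MCauchy_def by (rule conjunct1)
  then have ran: "\<sigma> n \<in> range q" for n
    by auto
  have "\<exists>N. \<forall>n n'. N \<le> n \<longrightarrow> N \<le> n' \<longrightarrow> vdist Quot (\<sigma> n) (\<sigma> n') < (1/2) ^ k" for k :: nat
    using \<sigma>[unfolded Quot_metric.MCauchy_def, THEN conjunct2] by simp
  then obtain N where
    N: "\<And>k n n'. N k \<le> n \<Longrightarrow> N k \<le> n' \<Longrightarrow> vdist Quot (\<sigma> n) (\<sigma> n') < (1/2) ^ k"
    by metis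
  have "\<exists>r. \<forall>k. N k \<le> r k \<and> r k < r (Suc k)"
  proof (rule dependent_nat_choice)
    show "\<exists>m. N 0 \<le> m" by blast
    show "\<exists>m'. N (Suc k) \<le> m' \<and> m < m'" for m k
      by (rule exI[of _ "N (Suc k) + Suc m"]) simp
  qed
  then obtain r where r: "\<And>k. N k \<le> r k" "\<And>k. r k < r (Suc k)"
    by blast
  have "\<exists>e. \<forall>k. q (e k) = \<sigma> (r k) \<and> norm (e (Suc k) - e k) < (1/2) ^ k"
  proof (rule dependent_nat_choice)
    show "\<exists>x. q x = \<sigma> (r 0)"
      using q_rep[OF ran] by blast
  next
    fix x k
    assume x: "q x = \<sigma> (r k)"
    obtain y where y: "q y = \<sigma> (r (Suc k))"
      using q_rep[OF ran] by blast
    have "vdist Quot (\<sigma> (r (Suc k))) (\<sigma> (r k)) < (1/2) ^ k"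
      using r(1)[of k] r(2)[of k] by (intro N) auto
    then have "infdist (y - x) M < (1/2) ^ k"
      by (simp flip: x y)
    then obtain a where "a \<in> M" "norm (y - x - a) < (1/2) ^ k"
      using infdist_less_iff by blast
    then show "\<exists>z. q z = \<sigma> (r (Suc k)) \<and> norm (z - x) < (1/2) ^ k"
      by (intro exI[of _ "y - a"])
        (auto simp: y[symmetric] q_eq_iff minus_M diff_diff_eq add.commute)
  qed
  then obtain e where e: "\<And>k. q (e k) = \<sigma> (r k)" "\<And>k. norm (e (Suc k) - e k) < (1/2) ^ k"
    by blast
  have "summable (\<lambda>k. e (Suc k) - e k)"
    by (rule summable_comparison_test'[where g = "\<lambda>k. (1/2) ^ k" and N = 0])
      (auto intro: less_imp_le e summable_geometric)
  then have "convergent (\<lambda>n. \<Sum>k<n. e (Suc k) - e k)"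
    by (simp add: summable_iff_convergent)
  then have "convergent (\<lambda>n. (e n - e 0) + e 0)"
    unfolding sum_lessThan_telescope by (intro convergent_add convergent_const)
  then obtain l where "e \<longlonglongrightarrow> l"
    by (auto simp: convergent_def)
  then have "(\<lambda>n. norm (e n - l)) \<longlonglongrightarrow> 0"
    by (intro tendsto_norm_zero LIM_zero)
  then have "(\<lambda>n. infdist (e n - l) M) \<longlonglongrightarrow> 0"
    by (rule tendsto_sandwich[rotated 3])
      (auto simp: infdist_le_norm infdist_nonneg)
  then have "limitin Quot_metric.mtopology (\<sigma> \<circ> r) (q l) sequentially"
    unfolding Quot_metric.limitin_metric_dist_null by (simp flip: e)
  then show "\<exists>u. limitin Quot_metric.mtopology \<sigma> u sequentially"
    using Quot_metric.MCauchy_convergent_subsequence[OF \<sigma>, of r "q l"] r(2)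
    by (auto simp: strict_mono_Suc_iff)
qed

lemma complex_banach_space_Quot: "complex_banach_space Quot"
proof
  show "Metric_space.mcomplete (pts Quot) (vdist Quot)"
    by (rule mcomplete_Quot)
  show "\<exists>v\<in>pts Quot. vadd Quot u v = vzero Quot" if "u \<in> pts Quot" for u
  proof -
    obtain x where "u = q x"
      using \<open>u \<in> pts Quot\<close> by auto
    then show ?thesis
      by (intro bexI[of _ "q (- x)"]) simp_all
  qed
qed (auto simp: add_ac scaleC_add_right scaleC_add_left scaleC_scaleC infdist_nonneg
    infdist_eq_0_iff q_eq_iff infdist_scaleC infdist_add_le
    intro!: rangeI)

lemma induced_q:
  assumes "L \<in> bounded_ops univ_space" and "L ` M \<subseteq> M"
  shows "induced L (q x) = q (L x)"
  unfolding induced_def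
  using assms(2) rep_q[of x] by (auto intro!: q_cong simp flip: bounded_ops_univ_spaceD(3)[OF assms(1)])

lemma induced_bounded_ops:
  assumes L: "L \<in> bounded_ops univ_space" and M: "L ` M \<subseteq> M"
  shows "induced L \<in> bounded_ops Quot"
proof -
  have "infdist (L x) M \<le> onorm L * infdist x M" for x
    by (intro infdist_image_le L M onorm onorm_pos_le bounded_ops_univ_spaceD[OF L])
  then show ?thesis
    unfolding bounded_ops_def
    by (auto simp: induced_q[OF L M] bounded_ops_univ_spaceD[OF L])
qed

end


section \<open>The semigroup on the given space\<close>

locale semigroup_with_generator =
  fixes T :: "real \<Rightarrow> 'a::cbanach \<Rightarrow> 'a" and A :: "'a oper"
  assumes semigroup: "C0_semigroup univ_space T"
    and generator: "generator_of univ_space T A"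
    and operator: "operator_on univ_space A"
begin

lemma T_bounded_ops: "t \<ge> 0 \<Longrightarrow> T t \<in> bounded_ops univ_space"
  and T_0: "T 0 x = x"
  and T_add: "s \<ge> 0 \<Longrightarrow> t \<ge> 0 \<Longrightarrow> T (s + t) x = T s (T t x)"
  using semigroup unfolding C0_semigroup_def univ_space_simps
  by simp_all

lemma T_commute: "s \<ge> 0 \<Longrightarrow> t \<ge> 0 \<Longrightarrow> T s (T t x) = T t (T s x)"
  by (metis T_add add.commute)

lemma T_tendsto: "t \<ge> 0 \<Longrightarrow> ((\<lambda>s. T s x) \<longlongrightarrow> T t x) (at t within {0..})"
proof (rule LIM_zero_cancel, rule tendsto_norm_zero_cancel)
  assume "t \<ge> 0"
  with semigroup show "((\<lambda>s. norm (T s x - T t x)) \<longlongrightarrow> 0) (at t within {0..})"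
    unfolding C0_semigroup_def vdist_def univ_space_simps vdiff_univ_space by simp
qed

lemma continuous_on_T: "continuous_on {0..} (\<lambda>s. T s x)"
  by (auto simp: continuous_on_def T_tendsto)

text \<open>
  Each orbit is bounded on a compact interval by continuity; uniform boundedness makes the bound
  independent of the orbit. It is the domination under which strong continuity passes to
  sequences.
\<close>

lemma T_locally_bounded: "\<exists>K\<ge>0. \<forall>t\<in>{0..a}. \<forall>x. norm (T t x) \<le> K * norm x"
proof -
  have "\<exists>K. \<forall>t\<in>{0..a}. norm (T t x) \<le> K" for x
  proof -
    have "compact ((\<lambda>t. T t x) ` {0..a})"
      by (intro compact_continuous_image continuous_on_subset[OF continuous_on_T]) auto
    from compact_imp_bounded[OF this] show ?thesis
      by (auto simp: bounded_iff)
  qed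
  then have "\<exists>K. \<forall>t\<in>{0..a}. \<forall>x. norm (T t x) \<le> K * norm x"
    by (intro uniform_boundedness) (auto intro: T_bounded_ops bounded_ops_univ_spaceD(1))
  then obtain K where K: "\<forall>t\<in>{0..a}. \<forall>x. norm (T t x) \<le> K * norm x"
    by blast
  have "norm (T t x) \<le> \<bar>K\<bar> * norm x" if "t \<in> {0..a}" for t x
    using K that mult_right_mono[OF abs_ge_self[of K] norm_ge_zero[of x]] order_trans by blast
  then show ?thesis
    by (intro exI[of _ "\<bar>K\<bar>"]) auto
qed

definition diff_quotient :: "real \<Rightarrow> 'a \<Rightarrow> 'a" where
  "diff_quotient t x = (1 / t) *\<^sub>R (T t x - x)"

lemma right_derivative_iff:
  "right_derivative_at_0 univ_space T x y \<longleftrightarrow> ((\<lambda>t. diff_quotient t x) \<longlongrightarrow> y) (at_right 0)"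
proof -
  have "vscale univ_space (complex_of_real (1 / t)) (vdiff univ_space (T t x) x) = diff_quotient t x" for t
    unfolding univ_space_simps vdiff_univ_space scaleC_of_real_left diff_quotient_def by (rule refl)
  then show ?thesis
    unfolding right_derivative_at_0_def vdist_def univ_space_simps vdiff_univ_space
      tendsto_norm_zero_iff LIM_zero_iff by simp
qed

lemma domain_appI: "((\<lambda>t. diff_quotient t x) \<longlongrightarrow> y) (at_right 0) \<Longrightarrow> x \<in> domain A \<and> app A x = y"
  using generator tendsto_unique[OF trivial_limit_at_right_real[of 0], of "\<lambda>t. diff_quotient t x"]
  unfolding generator_of_def right_derivative_iff univ_space_simps by blast

lemma diff_quotient_tendsto: "x \<in> domain A \<Longrightarrow> ((\<lambda>t. diff_quotient t x) \<longlongrightarrow> app A x) (at_right 0)"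
  using generator by (simp add: generator_of_def right_derivative_iff)

text \<open>
  Since \<open>T t\<close> commutes with the semigroup, it maps the difference quotients at \<open>x\<close> to those at
  \<open>T t x\<close>, and being continuous it maps their limit to the limit.
\<close>

lemma T_commutant:
  assumes "t \<ge> 0"
  shows "T t \<in> commutant univ_space A"
proof -
  note T = bounded_ops_univ_spaceD[OF T_bounded_ops[OF assms]]
  have "T t x \<in> domain A \<and> app A (T t x) = T t (app A x)" if "x \<in> domain A" for x
  proof (rule domain_appI)
    have "((\<lambda>h. T t (diff_quotient h x)) \<longlongrightarrow> T t (app A x)) (at_right 0)"
      by (rule bounded_linear.tendsto[OF T(1) diff_quotient_tendsto[OF that]])
    moreover have "\<forall>\<^sub>F h in at_right 0. T t (diff_quotient h x) = diff_quotient h (T t x)"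
      using eventually_at_right_less[of 0]
      by eventually_elim (simp add: diff_quotient_def T T_commute assms)
    ultimately show "((\<lambda>h. diff_quotient h (T t x)) \<longlongrightarrow> T t (app A x)) (at_right 0)"
      by (rule Lim_transform_eventually)
  qed
  then show ?thesis
    by (simp add: commutant_def T_bounded_ops assms)
qed

definition mean :: "real \<Rightarrow> 'a \<Rightarrow> 'a" where
  "mean t x = (1 / t) *\<^sub>R integral {0..t} (\<lambda>s. T s x)"

lemma T_integrable: "0 \<le> a \<Longrightarrow> (\<lambda>s. T s x) integrable_on {a..b}"
  by (intro integrable_continuous_real continuous_on_subset[OF continuous_on_T]) auto

lemma norm_mean_le:
  assumes "t > 0" and K: "\<forall>s\<in>{0..t}. \<forall>x. norm (T s x) \<le> K * norm x"
  shows "norm (mean t x) \<le> K * norm x"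
proof -
  have "norm (integral {0..t} (\<lambda>s. T s x)) \<le> K * norm x * (t - 0)"
    using assms by (intro integral_bound continuous_on_subset[OF continuous_on_T]) auto
  then show ?thesis
    using \<open>t > 0\<close> by (simp add: mean_def field_simps)
qed

lemma mean_bounded_ops:
  assumes "t > 0"
  shows "mean t \<in> bounded_ops univ_space"
proof -
  obtain K where "\<forall>s\<in>{0..t}. \<forall>x. norm (T s x) \<le> K * norm x"
    using T_locally_bounded[of t] by blast
  then have "\<forall>x. norm (mean t x) \<le> K * norm x"
    using norm_mean_le[OF assms] by blast
  moreover have "mean t (x + y) = mean t x + mean t y" for x y
  proof -
    have "integral {0..t} (\<lambda>s. T s (x + y)) = integral {0..t} (\<lambda>s. T s x + T s y)"
      by (intro integral_cong) (auto intro: bounded_ops_univ_spaceD T_bounded_ops)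
    then show ?thesis
      by (simp add: mean_def integral_add T_integrable scaleR_add_right)
  qed
  moreover have "mean t (a *\<^sub>C x) = a *\<^sub>C mean t x" for a x
  proof -
    have "integral {0..t} (\<lambda>s. T s (a *\<^sub>C x)) = integral {0..t} (\<lambda>s. a *\<^sub>C T s x)"
      by (intro integral_cong) (auto intro: bounded_ops_univ_spaceD T_bounded_ops)
    also have "\<dots> = a *\<^sub>C integral {0..t} (\<lambda>s. T s x)"
      using integral_linear[OF T_integrable bounded_linear_scaleC] by (simp add: o_def)
    finally show ?thesis
      by (simp add: mean_def scaleC_scaleC mult.commute flip: scaleC_of_real_left)
  qed
  ultimately show ?thesis
    by (auto simp: bounded_ops_def)
qed

lemma integral_T_tendsto:
  assumes "a \<ge> 0"
  shows "((\<lambda>h. (1 / h) *\<^sub>R integral {a..a + h} (\<lambda>s. T s x)) \<longlongrightarrow> T a x) (at_right 0)"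
proof -
  have "((\<lambda>u. integral {a..u} (\<lambda>s. T s x)) has_vector_derivative T a x) (at a within {a..a + 1})"
    using assms by (intro integral_has_vector_derivative continuous_on_subset[OF continuous_on_T]) auto
  then have "((\<lambda>u. norm (integral {a..u} (\<lambda>s. T s x) - (u - a) *\<^sub>R T a x) / norm (u - a)) \<longlongrightarrow> 0)
      (at a within {a..a + 1})"
    by (simp add: has_vector_derivative_def has_derivative_iff_norm)
  moreover have "\<forall>\<^sub>F u in at a within {a..a + 1}.
      norm (integral {a..u} (\<lambda>s. T s x) - (u - a) *\<^sub>R T a x) / norm (u - a) =
      norm ((1 / (u - a)) *\<^sub>R integral {a..u} (\<lambda>s. T s x) - T a x)"
  proof (rule eventually_at_filter[THEN iffD2, OF always_eventually], intro allI impI)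
    fix u :: real
    assume "u \<noteq> a"
    then have "(1 / (u - a)) *\<^sub>R integral {a..u} (\<lambda>s. T s x) - T a x =
        (1 / (u - a)) *\<^sub>R (integral {a..u} (\<lambda>s. T s x) - (u - a) *\<^sub>R T a x)"
      by (simp add: scaleR_diff_right)
    then show "norm (integral {a..u} (\<lambda>s. T s x) - (u - a) *\<^sub>R T a x) / norm (u - a) =
        norm ((1 / (u - a)) *\<^sub>R integral {a..u} (\<lambda>s. T s x) - T a x)"
      by simp
  qed
  ultimately have "((\<lambda>u. norm ((1 / (u - a)) *\<^sub>R integral {a..u} (\<lambda>s. T s x) - T a x)) \<longlongrightarrow> 0)
      (at a within {a..a + 1})"
    by (rule Lim_transform_eventually)
  then have "((\<lambda>u. (1 / (u - a)) *\<^sub>R integral {a..u} (\<lambda>s. T s x)) \<longlongrightarrow> T a x) (at_right a)"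
    by (simp add: at_within_Icc_at_right tendsto_norm_zero_iff LIM_zero_iff)
  then show ?thesis
    by (simp add: filterlim_at_right_to_0[of _ _ a] add.commute)
qed

lemma mean_tendsto: "((\<lambda>t. mean t x) \<longlongrightarrow> x) (at_right 0)"
  using integral_T_tendsto[of 0 x] by (simp add: mean_def T_0)

text \<open>
  Applying \<open>T h - 1\<close> to an integral over \<open>[0, t]\<close> shifts the interval by \<open>h\<close>, so only two short
  intervals at its ends survive.
\<close>

lemma mean_in_domain:
  assumes "t > 0"
  shows "mean t x \<in> domain A" and "app A (mean t x) = diff_quotient t x"
proof -
  define J where "J a b = integral {a..b} (\<lambda>s. T s x)" for a b
  have combine: "J a b + J b c = J a c" if "0 \<le> a" "a \<le> b" "b \<le> c" for a b c
    unfolding J_def using that by (intro Henstock_Kurzweil_Integration.integral_combine T_integrable)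
  have shift: "T h (J 0 t) = J h (t + h)" if "h \<ge> 0" for h
  proof -
    have "T h (J 0 t) = integral {0..t} (\<lambda>s. T h (T s x))"
      unfolding J_def
      using integral_linear[OF T_integrable bounded_ops_univ_spaceD(1)[OF T_bounded_ops[OF that]]]
      by (simp add: o_def)
    also have "\<dots> = integral {0..t} (\<lambda>s. T (s + h) x)"
      using that by (intro integral_cong) (simp add: add.commute flip: T_add)
    also have "\<dots> = J h (t + h)"
      unfolding J_def
      using integral_shift_Icc_real[of 0 t "\<lambda>s. T s x" h] by (simp add: o_def add.commute)
    finally show ?thesis .
  qed
  have diff_quotient_mean: "diff_quotient h (mean t x) =
      (1 / t) *\<^sub>R ((1 / h) *\<^sub>R J t (t + h) - (1 / h) *\<^sub>R J 0 (0 + h))" if "h > 0" for h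
  proof -
    have "J h (t + h) - J 0 t = J t (t + h) - J 0 h"
      using combine[of 0 h "t + h"] combine[of 0 t "t + h"] that assms by (simp add: algebra_simps)
    then show ?thesis
      using that shift[of h] bounded_ops_univ_spaceD(5)[OF T_bounded_ops[of h]]
      by (simp add: diff_quotient_def mean_def flip: J_def scaleR_diff_right)
  qed
  have "((\<lambda>h. (1 / t) *\<^sub>R ((1 / h) *\<^sub>R J t (t + h) - (1 / h) *\<^sub>R J 0 (0 + h))) \<longlongrightarrow>
      (1 / t) *\<^sub>R (T t x - T 0 x)) (at_right 0)"
    unfolding J_def using assms by (intro tendsto_intros integral_T_tendsto) auto
  moreover have "\<forall>\<^sub>F h in at_right 0.
      (1 / t) *\<^sub>R ((1 / h) *\<^sub>R J t (t + h) - (1 / h) *\<^sub>R J 0 (0 + h)) = diff_quotient h (mean t x)"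
    using eventually_at_right_less[of 0] by eventually_elim (simp only: diff_quotient_mean)
  ultimately have "((\<lambda>h. diff_quotient h (mean t x)) \<longlongrightarrow> diff_quotient t x) (at_right 0)"
    unfolding diff_quotient_def[of t] T_0 by (rule Lim_transform_eventually)
  then show "mean t x \<in> domain A" "app A (mean t x) = diff_quotient t x"
    using domain_appI by blast+
qed

end


section \<open>Adjoining an inverse of the generator\<close>

locale bounded_below_generator = semigroup_with_generator T A
  for T :: "real \<Rightarrow> 'a::cbanach \<Rightarrow> 'a" and A +
  fixes c :: real
  assumes c_pos: "c > 0"
    and bounded_below: "x \<in> domain A \<Longrightarrow> c * norm x \<le> norm (app A x)"
begin

text \<open>
  Elements of \<open>'a ell1\<close> are read as power series in \<open>z\<close>, which is to become the inverse of the
  generator. Giving \<open>z\<close> the norm \<open>1 / c\<close> by rescaling the shift keeps the sequence space unweighted.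
\<close>

definition mult_z :: "'a ell1 \<Rightarrow> 'a ell1" where
  "mult_z f = (1 / c) *\<^sub>R push f"

text \<open>
  The relations \<open>(1 - z A) g = 0\<close>. All summable \<open>g\<close> with values in the domain and summable \<open>A g\<close>
  are admitted rather than only finite sums \<open>x z\<^sup>n - A x z\<^sup>n\<^sup>+\<^sup>1\<close>, so that elements such as
  coefficientwise orbit means yield relations without an approximation argument.
\<close>

definition relations :: "'a ell1 set" where
  "relations = {g - mult_z h |g h. \<forall>n. coeff g n \<in> domain A \<and> coeff h n = app A (coeff g n)}"

text \<open>
  A coset is represented by the coefficient sequences of its elements, so that its type mentions
  only \<open>'a\<close> and not \<open>'a ell1\<close>.
\<close>

definition coset :: "'a ell1 \<Rightarrow> (nat \<Rightarrow> 'a) set" where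
  "coset f = coeff ` {g. g - f \<in> closure relations}"

lemma coeff_mult_z: "coeff (mult_z f) n = (if n = 0 then 0 else (1 / c) *\<^sub>R coeff f (n - 1))"
  by (simp add: mult_z_def coeff_push)

lemma norm_mult_z: "norm (mult_z f) = norm f / c"
  using c_pos by (simp add: mult_z_def norm_push)

lemma norm_single_add_mult_z: "norm (single x + mult_z h) = norm x + norm h / c"
proof -
  have "mult_z h = push ((1 / c) *\<^sub>R h)"
    by (intro ell1_eqI) (simp add: coeff_mult_z coeff_push)
  then show ?thesis
    using c_pos by (simp add: norm_single_push)
qed

lemma mult_z_bounded_ops: "mult_z \<in> bounded_ops univ_space"
  unfolding bounded_ops_def
proof (intro CollectI conjI ballI allI)
  show "\<exists>K. \<forall>f\<in>pts univ_space. vnorm univ_space (mult_z f) \<le> K * vnorm univ_space f"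
    by (intro exI[of _ "1 / c"]) (simp add: norm_mult_z)
qed (auto intro!: ell1_eqI simp: coeff_mult_z scaleR_add_right scaleC_scaleR)

lemmas mult_z_linear = bounded_ops_univ_spaceD[OF mult_z_bounded_ops]

lemma zero_in_domain: "0 \<in> domain A" and app_zero: "app A 0 = 0"
  and domain_add: "x \<in> domain A \<Longrightarrow> y \<in> domain A \<Longrightarrow> x + y \<in> domain A"
  and app_add: "x \<in> domain A \<Longrightarrow> y \<in> domain A \<Longrightarrow> app A (x + y) = app A x + app A y"
  and domain_scaleC: "x \<in> domain A \<Longrightarrow> a *\<^sub>C x \<in> domain A"
  and app_scaleC: "x \<in> domain A \<Longrightarrow> app A (a *\<^sub>C x) = a *\<^sub>C app A x"
proof -
  note * = operator[unfolded operator_on_def univ_space_simps]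
  show zero: "0 \<in> domain A" and "x \<in> domain A \<Longrightarrow> y \<in> domain A \<Longrightarrow> x + y \<in> domain A"
    and add: "x \<in> domain A \<Longrightarrow> y \<in> domain A \<Longrightarrow> app A (x + y) = app A x + app A y"
    and "x \<in> domain A \<Longrightarrow> a *\<^sub>C x \<in> domain A"
    and "x \<in> domain A \<Longrightarrow> app A (a *\<^sub>C x) = a *\<^sub>C app A x" for x y a
    using * by auto
  show "app A 0 = 0"
    using add[OF zero zero] by simp
qed

lemma app_scaleR:
  assumes "x \<in> domain A"
  shows "r *\<^sub>R x \<in> domain A" and "app A (r *\<^sub>R x) = r *\<^sub>R app A x"
  using domain_scaleC[OF assms, of "complex_of_real r"] app_scaleC[OF assms, of "complex_of_real r"]
  by simp_all

lemma relationsI: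
  "(\<And>n. coeff g n \<in> domain A) \<Longrightarrow> (\<And>n. coeff h n = app A (coeff g n)) \<Longrightarrow>
    g - mult_z h \<in> relations"
  unfolding relations_def by blast

lemma relations_subset: "relations \<subseteq> closure relations"
  by (rule closure_subset)

lemma relations_add:
  assumes "u \<in> relations" and "v \<in> relations"
  shows "u + v \<in> relations"
proof -
  obtain g h where u: "u = g - mult_z h"
      "\<forall>n. coeff g n \<in> domain A \<and> coeff h n = app A (coeff g n)"
    using assms(1) unfolding relations_def by blast
  obtain g' h' where v: "v = g' - mult_z h'"
      "\<forall>n. coeff g' n \<in> domain A \<and> coeff h' n = app A (coeff g' n)"
    using assms(2) unfolding relations_def by blast
  have "u + v = (g + g') - mult_z (h + h')"
    by (simp add: u v mult_z_linear)
  also have "\<dots> \<in> relations"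
    using u v by (intro relationsI) (auto simp: domain_add app_add)
  finally show ?thesis .
qed

text \<open>
  Whatever commutes with both \<open>z\<close> and \<open>A\<close> sends \<open>(1 - z A) g\<close> to \<open>(1 - z A) (L g)\<close>. This serves
  for complex scalars, for \<open>z\<close> itself and for the commutant of \<open>A\<close>.
\<close>

lemma bounded_op_relations:
  assumes L: "L \<in> bounded_ops univ_space" and commute: "\<And>f. L (mult_z f) = mult_z (L f)"
    and L_dom: "\<And>g h. (\<And>n. coeff g n \<in> domain A \<and> coeff h n = app A (coeff g n)) \<Longrightarrow>
      \<forall>n. coeff (L g) n \<in> domain A \<and> coeff (L h) n = app A (coeff (L g) n)"
  shows "L ` closure relations \<subseteq> closure relations"
proof (rule image_closure_subset)
  show "continuous_on (closure relations) L"
    by (rule linear_continuous_on[OF bounded_ops_univ_spaceD(1)[OF L]])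
  show "L ` relations \<subseteq> closure relations"
  proof
    fix v
    assume "v \<in> L ` relations"
    then obtain g h where "v = L (g - mult_z h)"
        and *: "\<And>n. coeff g n \<in> domain A \<and> coeff h n = app A (coeff g n)"
      unfolding relations_def by blast
    then have "v = L g - mult_z (L h)"
      by (simp add: bounded_ops_univ_spaceD[OF L] commute)
    then show "v \<in> closure relations"
      using relationsI[of "L g" "L h"] L_dom[OF *] relations_subset by auto
  qed
qed simp

lemma scaleC_relations: "(*\<^sub>C) a ` closure relations \<subseteq> closure relations"
  by (rule bounded_op_relations)
    (auto simp: bounded_ops_univ_space bounded_linear_scaleC scaleC_scaleC mult.commute
      mult_z_linear domain_scaleC app_scaleC)

lemma mult_z_relations: "mult_z ` closure relations \<subseteq> closure relations"
  by (rule bounded_op_relations)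
    (auto simp: mult_z_bounded_ops coeff_mult_z zero_in_domain app_zero app_scaleR)

lemma commutant_bounded_ops: "U \<in> commutant univ_space A \<Longrightarrow> U \<in> bounded_ops univ_space"
  by (simp add: commutant_def)

lemma ell1_map_mult_z:
  assumes "U \<in> bounded_ops univ_space"
  shows "ell1_map U (mult_z f) = mult_z (ell1_map U f)"
  by (intro ell1_eqI) (simp add: coeff_ell1_map coeff_mult_z bounded_ops_univ_spaceD[OF assms])

lemma ell1_map_relations:
  assumes "U \<in> commutant univ_space A"
  shows "ell1_map U ` closure relations \<subseteq> closure relations"
proof (rule bounded_op_relations)
  note U = commutant_bounded_ops[OF assms]
  show "ell1_map U \<in> bounded_ops univ_space"
    by (rule ell1_map_bounded_ops[OF U])
  show "ell1_map U (mult_z f) = mult_z (ell1_map U f)" for f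
    by (rule ell1_map_mult_z[OF U])
  show "\<forall>n. coeff (ell1_map U g) n \<in> domain A \<and>
      coeff (ell1_map U h) n = app A (coeff (ell1_map U g) n)"
    if "\<And>n. coeff g n \<in> domain A \<and> coeff h n = app A (coeff g n)" for g h
    using assms that by (auto simp: commutant_def coeff_ell1_map bounded_ops_univ_spaceD[OF U])
qed

sublocale Y: banach_quotient "closure relations" coset
proof
  show zero: "0 \<in> closure relations"
    using relationsI[of 0 0] relations_subset zero_in_domain app_zero
    by (auto simp: mult_z_linear)
  show add: "x + y \<in> closure relations"
    if xy: "x \<in> closure relations" "y \<in> closure relations" for x y
  proof -
    obtain u v where uv: "\<And>n. u n \<in> relations" "u \<longlonglongrightarrow> x" "\<And>n. v n \<in> relations" "v \<longlonglongrightarrow> y"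
      using xy unfolding closure_sequential by metis
    have "(\<lambda>n. u n + v n) \<longlonglongrightarrow> x + y"
      by (intro tendsto_add uv)
    with uv show ?thesis
      unfolding closure_sequential
      by (intro exI[of _ "\<lambda>n. u n + v n"]) (simp add: relations_add)
  qed
  show scaleC: "a *\<^sub>C x \<in> closure relations" if "x \<in> closure relations" for a x
    using scaleC_relations that by blast
  show "coset f = coset g \<longleftrightarrow> f - g \<in> closure relations" for f g
  proof
    assume "coset f = coset g"
    moreover have "coeff f \<in> coset f"
      using zero by (auto simp: coset_def)
    ultimately show "f - g \<in> closure relations"
      by (auto simp: coset_def coeff_inject)
  next
    assume fg: "f - g \<in> closure relations"
    have "h - f \<in> closure relations \<longleftrightarrow> h - g \<in> closure relations" for h
      using add[of "h - f" "f - g"] add[of "h - g" "- (f - g)"] fg scaleC[OF fg, of "-1"]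
      by (auto simp: scaleC_minus_one)
    then show "coset f = coset g"
      by (simp add: coset_def)
  qed
qed simp

lemma coset_eq_mult_z:
  "(\<And>n. coeff g n \<in> domain A) \<Longrightarrow> (\<And>n. coeff h n = app A (coeff g n)) \<Longrightarrow>
    coset g = coset (mult_z h)"
  using relationsI relations_subset by (intro Y.q_cong) blast

text \<open>
  The two summands of \<open>x + z h\<close> occupy different coefficients, and \<open>h = A g\<close> has norm at least
  \<open>c\<close> times that of \<open>g\<close>; so subtracting \<open>g\<close> cannot undercut the norm of \<open>x\<close>.
\<close>

lemma infdist_single: "infdist (single x) (closure relations) = norm x"
proof (rule antisym)
  show "infdist (single x) (closure relations) \<le> norm x"
    using Y.infdist_le_norm[of "single x"] by (simp add: norm_single)
  have "norm x \<le> dist (single x) w" if w_rel: "w \<in> relations" for w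
  proof -
    obtain g h where w: "w = g - mult_z h"
        and gh: "\<And>n. coeff g n \<in> domain A" "\<And>n. coeff h n = app A (coeff g n)"
      using w_rel unfolding relations_def by blast
    have "c * norm g \<le> norm h"
      unfolding norm_ell1_def suminf_mult[OF summable_norm_coeff, symmetric]
      by (intro suminf_le summable_mult summable_norm_coeff) (simp add: gh bounded_below)
    then have "norm g \<le> norm h / c"
      using c_pos by (simp add: field_simps)
    moreover have "norm x + norm h / c - norm g \<le> norm (single x + mult_z h - g)"
      using norm_triangle_ineq2[of "single x + mult_z h" g] by (simp add: norm_single_add_mult_z)
    ultimately show ?thesis
      by (simp add: w dist_norm algebra_simps)
  qed
  then have "closure relations \<subseteq> {w. norm x \<le> dist (single x) w}"
    by (intro closure_minimal closed_Collect_le continuous_intros) auto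
  then show "norm x \<le> infdist (single x) (closure relations)"
    unfolding infdist_notempty[of "closure relations", OF ex_in_conv[THEN iffD1, OF exI, OF Y.zero_M]]
    using Y.zero_M by (intro cINF_greatest) auto
qed

definition embed :: "'a \<Rightarrow> (nat \<Rightarrow> 'a) set" where
  "embed x = coset (single x)"

definition lift :: "('a \<Rightarrow> 'a) \<Rightarrow> (nat \<Rightarrow> 'a) set \<Rightarrow> (nat \<Rightarrow> 'a) set" where
  "lift U = Y.induced (ell1_map U)"

definition inverse_op :: "(nat \<Rightarrow> 'a) set \<Rightarrow> (nat \<Rightarrow> 'a) set" where
  "inverse_op = Y.induced mult_z"

text \<open>
  The generator is introduced as the inverse of multiplication by \<open>z\<close>; this is well-defined by
  \<open>inj_on_inverse_op\<close>, and \<open>generator_of_T_ext\<close> shows that it generates the lifted semigroup.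
\<close>

definition B :: "(nat \<Rightarrow> 'a) set oper" where
  "B = \<lparr>domain = inverse_op ` pts Y.Quot, app = inv_into (pts Y.Quot) inverse_op\<rparr>"

lemma isometric_embedding_embed: "isometric_embedding univ_space Y.Quot embed"
proof -
  have "single (x + y) = single x + single y" "single (a *\<^sub>C x) = a *\<^sub>C single x" for x y :: 'a and a
    by (auto intro!: ell1_eqI simp: coeff_single)
  then show ?thesis
    by (auto simp: isometric_embedding_def embed_def infdist_single)
qed

lemma single_diff: "single (x - y) = single x - single (y :: 'a)"
  by (auto intro!: ell1_eqI simp: coeff_single)

lemma vdist_embed: "vdist Y.Quot (embed x) (embed y) = norm (x - y)"
  by (simp add: embed_def infdist_single flip: single_diff)

lemma lift_coset: "U \<in> commutant univ_space A \<Longrightarrow> lift U (coset f) = coset (ell1_map U f)"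
  unfolding lift_def
  by (intro Y.induced_q ell1_map_bounded_ops ell1_map_relations commutant_bounded_ops)

lemma lift_bounded_ops: "U \<in> commutant univ_space A \<Longrightarrow> lift U \<in> bounded_ops Y.Quot"
  unfolding lift_def
  by (intro Y.induced_bounded_ops ell1_map_bounded_ops ell1_map_relations commutant_bounded_ops)

lemma lift_embed:
  assumes "U \<in> commutant univ_space A"
  shows "lift U (embed x) = embed (U x)"
proof -
  have "ell1_map U (single x) = single (U x)"
    using bounded_ops_univ_spaceD[OF commutant_bounded_ops[OF assms]]
    by (intro ell1_eqI) (simp add: coeff_ell1_map coeff_single)
  then show ?thesis
    by (simp add: embed_def lift_coset assms)
qed

lemma inverse_op_coset: "inverse_op (coset f) = coset (mult_z f)"
  unfolding inverse_op_def by (rule Y.induced_q[OF mult_z_bounded_ops mult_z_relations])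

lemma inverse_op_bounded_ops: "inverse_op \<in> bounded_ops Y.Quot"
  unfolding inverse_op_def by (rule Y.induced_bounded_ops[OF mult_z_bounded_ops mult_z_relations])

lemma infdist_mult_z_le:
  "infdist (mult_z f) (closure relations) \<le> (1 / c) * infdist f (closure relations)"
  by (rule Y.infdist_image_le[OF mult_z_bounded_ops mult_z_relations])
    (use c_pos in \<open>simp_all add: norm_mult_z\<close>)


section \<open>The semigroup on the extended space\<close>

definition T_ext :: "real \<Rightarrow> (nat \<Rightarrow> 'a) set \<Rightarrow> (nat \<Rightarrow> 'a) set" where
  "T_ext t = lift (T t)"

lemma T_ext_coset: "t \<ge> 0 \<Longrightarrow> T_ext t (coset f) = coset (ell1_map (T t) f)"
  by (simp add: T_ext_def lift_coset T_commutant)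

lemma C0_semigroup_T_ext: "C0_semigroup Y.Quot T_ext"
  unfolding C0_semigroup_def
proof (intro conjI allI impI ballI)
  show "T_ext t \<in> bounded_ops Y.Quot" if "t \<ge> 0" for t
    by (simp add: T_ext_def lift_bounded_ops T_commutant that)
  show "T_ext 0 u = u" if "u \<in> pts Y.Quot" for u
  proof -
    have "ell1_map (T 0) f = f" for f
      by (intro ell1_eqI) (simp add: coeff_ell1_map T_0 bounded_ops_univ_spaceD(1)[OF T_bounded_ops])
    with that show ?thesis
      by (auto simp: T_ext_coset)
  qed
  show "T_ext (s + t) u = T_ext s (T_ext t u)" if "s \<ge> 0" "t \<ge> 0" "u \<in> pts Y.Quot" for s t u
  proof -
    have "ell1_map (T (s + t)) f = ell1_map (T s) (ell1_map (T t) f)" for f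
      using that
      by (intro ell1_eqI) (simp add: coeff_ell1_map T_add bounded_ops_univ_spaceD(1)[OF T_bounded_ops])
    with that show ?thesis
      by (auto simp: T_ext_coset)
  qed
  show "((\<lambda>s. vdist Y.Quot (T_ext s u) (T_ext t u)) \<longlongrightarrow> 0) (at t within {0..})"
    if u_pts: "u \<in> pts Y.Quot" and t: "t \<ge> 0" for t u
  proof -
    obtain f where u: "u = coset f"
      using u_pts by auto
    obtain K where K: "\<forall>s\<in>{0..t + 1}. \<forall>x. norm (T s x) \<le> K * norm x"
      using T_locally_bounded by blast
    have ge: "\<forall>\<^sub>F s in at t within {0..}. s \<ge> 0"
      by (simp add: eventually_at_filter)
    moreover have "\<forall>\<^sub>F s in at t within {0..}. s < t + 1"
      using order_tendstoD(2)[OF tendsto_ident_at[of t "{0..}"], of "t + 1"] by simp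
    ultimately have bound: "\<forall>\<^sub>F s in at t within {0..}. \<forall>x. norm (T s x) \<le> K * norm x"
      by eventually_elim (use K in auto)
    have "((\<lambda>s. ell1_map (T s) f) \<longlongrightarrow> ell1_map (T t) f) (at t within {0..})"
    proof (rule tendsto_ell1_map[OF _ bound])
      show "\<forall>\<^sub>F s in at t within {0..}. bounded_linear (T s)"
        using ge by eventually_elim (rule bounded_ops_univ_spaceD(1)[OF T_bounded_ops])
    qed (use t T_tendsto T_bounded_ops bounded_ops_univ_spaceD(1) in auto)
    then have "((\<lambda>s. norm (ell1_map (T s) f - ell1_map (T t) f)) \<longlongrightarrow> 0) (at t within {0..})"
      by (intro tendsto_norm_zero LIM_zero)
    then show ?thesis
    proof (rule tendsto_sandwich[OF _ _ tendsto_const, rotated 2])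
      show "\<forall>\<^sub>F s in at t within {0..}. 0 \<le> vdist Y.Quot (T_ext s u) (T_ext t u)"
        by simp
      show "\<forall>\<^sub>F s in at t within {0..}.
          vdist Y.Quot (T_ext s u) (T_ext t u) \<le> norm (ell1_map (T s) f - ell1_map (T t) f)"
        using ge by eventually_elim (simp add: u T_ext_coset t Y.infdist_le_norm)
    qed
  qed
qed

lemma right_derivative_coset_iff:
  "right_derivative_at_0 Y.Quot T_ext (coset f) (coset g) \<longleftrightarrow>
    ((\<lambda>t. infdist ((1 / t) *\<^sub>R (ell1_map (T t) f - f) - g) (closure relations)) \<longlongrightarrow> 0) (at_right 0)"
proof -
  have "\<forall>\<^sub>F t in at_right 0.
      vdist Y.Quot (vscale Y.Quot (complex_of_real (1 / t)) (vdiff Y.Quot (T_ext t (coset f)) (coset f)))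
        (coset g) =
      infdist ((1 / t) *\<^sub>R (ell1_map (T t) f - f) - g) (closure relations)"
    using eventually_at_right_less[of 0]
  proof eventually_elim
    case (elim t)
    show ?case
      unfolding T_ext_coset[OF less_imp_le[OF elim]] Y.vdiff_q Y.Quot_simps scaleC_of_real_left Y.vdist_q
      by (rule refl)
  qed
  then show ?thesis
    unfolding right_derivative_at_0_def by (rule tendsto_cong)
qed

lemma right_derivative_unique:
  assumes "right_derivative_at_0 Y.Quot T_ext u v" "right_derivative_at_0 Y.Quot T_ext u w"
    and "u \<in> pts Y.Quot" "v \<in> pts Y.Quot" "w \<in> pts Y.Quot"
  shows "v = w"
proof -
  obtain f g h where q: "u = coset f" "v = coset g" "w = coset h"
    using assms(3-5) by auto
  define d where "d t = (1 / t) *\<^sub>R (ell1_map (T t) f - f)" for t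
  have "((\<lambda>t. infdist (d t - h) (closure relations) + infdist (d t - g) (closure relations))
      \<longlongrightarrow> 0 + 0) (at_right 0)"
    using assms(1,2) unfolding q right_derivative_coset_iff d_def by (intro tendsto_add)
  moreover have "infdist (g - h) (closure relations) \<le>
      infdist (d t - h) (closure relations) + infdist (d t - g) (closure relations)" for t
  proof -
    have "infdist (g - d t) (closure relations) = infdist (d t - g) (closure relations)"
      using Y.infdist_scaleC[of "-1" "d t - g"] by (simp add: scaleC_minus_one)
    then show ?thesis
      using Y.infdist_add_le[of "d t - h" "g - d t"] by simp
  qed
  ultimately have "infdist (g - h) (closure relations) \<le> 0"
    using tendsto_lowerbound[OF _ always_eventually trivial_limit_at_right_real] by fastforce
  then have "infdist (g - h) (closure relations) = 0"
    by (intro antisym infdist_nonneg)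
  then have "g - h \<in> closure relations"
    using Y.infdist_eq_0_iff by blast
  then show ?thesis
    by (simp add: q Y.q_cong)
qed

text \<open>
  The orbit means \<open>V\<^sub>t x = mean t x\<close> lie in the domain of \<open>A\<close> and satisfy \<open>A V\<^sub>t x = (T t x - x) / t\<close>. The
  relation \<open>g = z A g\<close> thus turns the difference quotient at \<open>z f\<close> into \<open>V\<^sub>t f\<close>, for every \<open>f\<close>,
  and the latter tends to \<open>f\<close>.
\<close>

lemma right_derivative_inverse_op:
  assumes "u \<in> pts Y.Quot"
  shows "right_derivative_at_0 Y.Quot T_ext (inverse_op u) u"
proof -
  obtain f where u: "u = coset f"
    using assms by auto
  obtain K where K: "\<forall>s\<in>{0..1}. \<forall>x. norm (T s x) \<le> K * norm x"
    using T_locally_bounded by blast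
  have pos: "\<forall>\<^sub>F t in at_right (0::real). 0 < t" and less: "\<forall>\<^sub>F t in at_right (0::real). t < 1"
    using eventually_at_right_real[of 0 "1::real"] by (auto elim: eventually_mono)
  have "((\<lambda>t. ell1_map (mean t) f) \<longlongrightarrow> ell1_map (\<lambda>x. x) f) (at_right 0)"
  proof (rule tendsto_ell1_map)
    show "\<forall>\<^sub>F t in at_right 0. bounded_linear (mean t)"
      using pos by eventually_elim (rule bounded_ops_univ_spaceD(1)[OF mean_bounded_ops])
    show "\<forall>\<^sub>F t in at_right 0. \<forall>x. norm (mean t x) \<le> K * norm x"
      using pos less by eventually_elim (use K in \<open>auto intro!: norm_mean_le\<close>)
  qed (auto intro: mean_tendsto)
  moreover have "ell1_map (\<lambda>x. x) f = f"
    by (intro ell1_eqI) (simp add: coeff_ell1_map)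
  ultimately have "((\<lambda>t. norm (ell1_map (mean t) f - f)) \<longlongrightarrow> 0) (at_right 0)"
    by (auto intro!: tendsto_norm_zero LIM_zero)
  then show ?thesis
    unfolding u inverse_op_coset right_derivative_coset_iff
  proof (rule tendsto_sandwich[OF _ _ tendsto_const, rotated 2])
    show "\<forall>\<^sub>F t in at_right 0.
        infdist ((1 / t) *\<^sub>R (ell1_map (T t) (mult_z f) - mult_z f) - f) (closure relations)
        \<le> norm (ell1_map (mean t) f - f)"
      using pos
    proof eventually_elim
      case (elim t)
      define h where "h = (1 / t) *\<^sub>R (ell1_map (T t) f - f)"
      have T: "T t \<in> bounded_ops univ_space"
        using elim by (simp add: T_bounded_ops)
      have "ell1_map (mean t) f - mult_z h \<in> closure relations"
        using mean_in_domain[OF elim] relations_subset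
        by (intro subsetD[OF relations_subset] relationsI)
          (simp_all add: h_def diff_quotient_def coeff_ell1_map
            bounded_ops_univ_spaceD(1)[OF T] bounded_ops_univ_spaceD(1)[OF mean_bounded_ops[OF elim]])
      then have "infdist (mult_z h - f) (closure relations) =
          infdist (ell1_map (mean t) f - f) (closure relations)"
        by (intro Y.infdist_cong) simp
      moreover have "(1 / t) *\<^sub>R (ell1_map (T t) (mult_z f) - mult_z f) = mult_z h"
        by (simp add: h_def ell1_map_mult_z[OF T] mult_z_linear)
      ultimately show ?case
        using Y.infdist_le_norm[of "ell1_map (mean t) f - f"] by simp
    qed
  qed (simp add: infdist_nonneg)
qed

lemma inverse_op_pts: "u \<in> pts Y.Quot \<Longrightarrow> inverse_op u \<in> pts Y.Quot"
  using inverse_op_bounded_ops unfolding bounded_ops_def by blast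

text \<open>The vector \<open>u\<close> is recovered from \<open>inverse_op u\<close> as the derivative of its orbit.\<close>

lemma inj_on_inverse_op: "inj_on inverse_op (pts Y.Quot)"
proof (rule inj_onI)
  fix u v
  assume uv: "u \<in> pts Y.Quot" "v \<in> pts Y.Quot" "inverse_op u = inverse_op v"
  show "u = v"
    using right_derivative_inverse_op[OF uv(1)] right_derivative_inverse_op[OF uv(2), folded uv(3)]
    by (rule right_derivative_unique) (use uv inverse_op_pts in auto)
qed

lemma app_B: "u \<in> pts Y.Quot \<Longrightarrow> app B (inverse_op u) = u"
  by (simp only: B_def oper.simps inv_into_f_f[OF inj_on_inverse_op])

lemma domain_B: "domain B = inverse_op ` pts Y.Quot"
  by (simp add: B_def)

lemma operator_on_B: "operator_on Y.Quot B"
proof -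
  interpret Q: complex_banach_space Y.Quot by (rule Y.complex_banach_space_Quot)
  have S: "inverse_op (vadd Y.Quot u v) = vadd Y.Quot (inverse_op u) (inverse_op v)"
    "inverse_op (vscale Y.Quot a u) = vscale Y.Quot a (inverse_op u)"
    if "u \<in> pts Y.Quot" "v \<in> pts Y.Quot" for u v a
    using inverse_op_bounded_ops that unfolding bounded_ops_def by blast+
  show ?thesis
    unfolding operator_on_def domain_B
  proof (intro conjI ballI allI)
    show "vzero Y.Quot \<in> inverse_op ` pts Y.Quot"
      by (rule image_eqI[of _ _ "coset 0"]) (simp_all add: inverse_op_coset mult_z_linear)
    show "vadd Y.Quot v w \<in> inverse_op ` pts Y.Quot"
      "app B (vadd Y.Quot v w) = vadd Y.Quot (app B v) (app B w)"
      if "v \<in> inverse_op ` pts Y.Quot" "w \<in> inverse_op ` pts Y.Quot" for v w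
      using that by (auto simp only: app_B Q.add_closed simp flip: S)
    show "vscale Y.Quot a v \<in> inverse_op ` pts Y.Quot"
      "app B (vscale Y.Quot a v) = vscale Y.Quot a (app B v)"
      if "v \<in> inverse_op ` pts Y.Quot" for v a
      using that by (auto simp only: app_B Q.scale_closed simp flip: S)
  qed (use inverse_op_pts app_B in auto)
qed

text \<open>
  The range of \<open>inverse_op\<close> consists of differentiable points by the above. Conversely, if \<open>u\<close> has
  derivative \<open>v\<close>, then \<open>inverse_op u\<close> has the derivative \<open>inverse_op v\<close> as \<open>inverse_op\<close> commutes
  with the semigroup; but its derivative is \<open>u\<close>, so \<open>u = inverse_op v\<close>.
\<close>

lemma generator_of_T_ext: "generator_of Y.Quot T_ext B"
  unfolding generator_of_def
proof (intro conjI ballI)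
  show "app B v \<in> pts Y.Quot" "right_derivative_at_0 Y.Quot T_ext v (app B v)" if "v \<in> domain B" for v
    using that right_derivative_inverse_op by (auto simp only: domain_B app_B)
  show "domain B = {u \<in> pts Y.Quot. \<exists>v\<in>pts Y.Quot. right_derivative_at_0 Y.Quot T_ext u v}"
  proof (intro equalityI subsetI)
    fix v
    assume "v \<in> domain B"
    then show "v \<in> {u \<in> pts Y.Quot. \<exists>v\<in>pts Y.Quot. right_derivative_at_0 Y.Quot T_ext u v}"
      using right_derivative_inverse_op inverse_op_pts unfolding domain_B by blast
  next
    fix u
    assume "u \<in> {u \<in> pts Y.Quot. \<exists>v\<in>pts Y.Quot. right_derivative_at_0 Y.Quot T_ext u v}"
    then obtain v where uv: "u \<in> pts Y.Quot" "v \<in> pts Y.Quot" "right_derivative_at_0 Y.Quot T_ext u v"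
      by blast
    then obtain f g where q: "u = coset f" "v = coset g"
      by auto
    have "right_derivative_at_0 Y.Quot T_ext (inverse_op u) (inverse_op v)"
      unfolding q inverse_op_coset right_derivative_coset_iff
    proof (rule tendsto_sandwich[OF _ _ tendsto_const])
      show "((\<lambda>t. (1 / c) * infdist ((1 / t) *\<^sub>R (ell1_map (T t) f - f) - g) (closure relations))
          \<longlongrightarrow> 0) (at_right 0)"
        using uv(3) unfolding q right_derivative_coset_iff by (rule tendsto_mult_right_zero)
      show "\<forall>\<^sub>F t in at_right 0.
          infdist ((1 / t) *\<^sub>R (ell1_map (T t) (mult_z f) - mult_z f) - mult_z g) (closure relations)
          \<le> (1 / c) * infdist ((1 / t) *\<^sub>R (ell1_map (T t) f - f) - g) (closure relations)"
        using eventually_at_right_less[of 0]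
      proof eventually_elim
        case (elim t)
        then have "(1 / t) *\<^sub>R (ell1_map (T t) (mult_z f) - mult_z f) - mult_z g =
            mult_z ((1 / t) *\<^sub>R (ell1_map (T t) f - f) - g)"
          by (simp add: ell1_map_mult_z T_bounded_ops mult_z_linear)
        then show ?case
          by (simp only: infdist_mult_z_le)
      qed
    qed (simp add: infdist_nonneg)
    then have "inverse_op v = u"
      by (rule right_derivative_unique[OF _ right_derivative_inverse_op])
        (use uv inverse_op_pts in auto)
    with uv(2) show "u \<in> domain B"
      unfolding domain_B by blast
  qed
qed

text \<open>
  If \<open>embed x\<close> has a right derivative, its difference quotients are images of those of \<open>x\<close>; the
  latter are Cauchy as the embedding is isometric, and they converge as \<open>X\<close> is complete.
\<close>

lemma embed_in_domain_B:
  assumes "embed x \<in> domain B"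
  shows "x \<in> domain A"
proof -
  interpret Q: complex_banach_space Y.Quot by (rule Y.complex_banach_space_Quot)
  define v where "v = app B (embed x)"
  have v: "v \<in> pts Y.Quot" "right_derivative_at_0 Y.Quot T_ext (embed x) v"
    using generator_of_T_ext assms by (auto simp: generator_of_def v_def)
  have embed_pts: "embed y \<in> pts Y.Quot" for y
    by (simp add: embed_def)
  have diff_quotient_embed: "vscale Y.Quot (complex_of_real (1 / t))
      (vdiff Y.Quot (T_ext t (embed x)) (embed x)) = embed (diff_quotient t x)" if "t > 0" for t
  proof -
    have "single (r *\<^sub>R y) = r *\<^sub>R single y" for r and y :: 'a
      by (auto intro!: ell1_eqI simp: coeff_single)
    then show ?thesis
      unfolding T_ext_def lift_embed[OF T_commutant[OF less_imp_le[OF that]]]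
      unfolding embed_def Y.vdiff_q Y.Quot_simps scaleC_of_real_left
      by (simp add: diff_quotient_def single_diff)
  qed
  have lim: "((\<lambda>t. vdist Y.Quot (embed (diff_quotient t x)) v) \<longlongrightarrow> 0) (at_right 0)"
    using v(2) unfolding right_derivative_at_0_def
    by (rule Lim_transform_eventually)
      (use eventually_at_right_less[of 0] in \<open>eventually_elim, simp only: diff_quotient_embed\<close>)
  \<comment> \<open>Completeness of \<open>X\<close> is applied along the times \<open>1 / (n + 1)\<close>.\<close>
  define y where "y n = diff_quotient (1 / Suc n) x" for n
  have "filterlim (\<lambda>n. 1 / real (Suc n)) (at_right 0) sequentially"
    unfolding filterlim_at using LIMSEQ_inverse_real_of_nat by (auto simp: inverse_eq_divide)
  then have y: "(\<lambda>n. vdist Y.Quot (embed (y n)) v) \<longlonglongrightarrow> 0"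
    unfolding y_def by (rule filterlim_compose[OF lim])
  have "Cauchy y"
  proof (rule metric_CauchyI)
    fix e :: real
    assume "e > 0"
    then have "\<forall>\<^sub>F n in sequentially. vdist Y.Quot (embed (y n)) v < e / 2"
      using order_tendstoD(2)[OF y, of "e / 2"] by simp
    then obtain N where N: "\<And>n. n \<ge> N \<Longrightarrow> vdist Y.Quot (embed (y n)) v < e / 2"
      by (auto simp: eventually_sequentially)
    have "dist (y m) (y n) < e" if "m \<ge> N" "n \<ge> N" for m n
      using Y.Quot_metric.triangle[OF embed_pts v(1) embed_pts, of "y m" "y n"]
        N[OF that(1)] N[OF that(2)]
      by (simp add: dist_norm vdist_embed Y.Quot_metric.commute[of v])
    then show "\<exists>N. \<forall>m\<ge>N. \<forall>n\<ge>N. dist (y m) (y n) < e"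
      by blast
  qed
  then obtain l where l: "y \<longlonglongrightarrow> l"
    using Cauchy_convergent_iff convergent_def by blast
  have "(\<lambda>n. norm (y n - l) + vdist Y.Quot (embed (y n)) v) \<longlonglongrightarrow> 0 + 0"
    by (intro tendsto_add y tendsto_norm_zero LIM_zero l)
  moreover have "vdist Y.Quot (embed l) v \<le> norm (y n - l) + vdist Y.Quot (embed (y n)) v" for n
    using Y.Quot_metric.triangle[OF embed_pts embed_pts v(1), of l "y n"]
    by (simp add: vdist_embed norm_minus_commute)
  ultimately have "vdist Y.Quot (embed l) v \<le> 0"
    using tendsto_lowerbound[OF _ always_eventually] by fastforce
  then have "vdist Y.Quot (embed l) v = 0"
    using Y.Quot_metric.nonneg[of "embed l" v] by linarith
  then have "v = embed l"
    using Y.Quot_metric.zero[OF embed_pts v(1)] by blast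
  then have "((\<lambda>t. diff_quotient t x) \<longlongrightarrow> l) (at_right 0)"
    using lim by (simp add: vdist_embed tendsto_norm_zero_iff LIM_zero_iff)
  then show ?thesis
    using domain_appI by blast
qed

lemma outer_extension_B: "outer_extension univ_space embed A B"
proof -
  have "embed x \<in> domain B \<and> app B (embed x) = embed (app A x)" if "x \<in> domain A" for x
  proof -
    have "embed x = inverse_op (embed (app A x))"
      unfolding embed_def inverse_op_coset
      using that by (intro coset_eq_mult_z) (auto simp: coeff_single zero_in_domain app_zero)
    moreover have "embed (app A x) \<in> pts Y.Quot"
      by (simp add: embed_def)
    ultimately show ?thesis
      by (simp only: domain_B app_B imageI simp_thms)
  qed
  then show ?thesis
    using embed_in_domain_B by (auto simp: outer_extension_def)
qed

lemma invertible_B: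
  shows "op_invertible Y.Quot B" and "op_norm Y.Quot (op_inverse B) \<le> inverse c"
proof -
  have *: "op_invertible Y.Quot B" "\<And>u. u \<in> pts Y.Quot \<Longrightarrow> op_inverse B u = inverse_op u"
    by (rule op_invertibleI[OF inverse_op_bounded_ops _ _ _ _ Y.complex_banach_space_Quot];
        auto simp only: domain_B app_B)+
  show "op_invertible Y.Quot B"
    by (rule *)
  show "op_norm Y.Quot (op_inverse B) \<le> inverse c"
  proof (rule op_norm_le)
    show "vnorm Y.Quot (op_inverse B u) \<le> inverse c * vnorm Y.Quot u" if "u \<in> pts Y.Quot" for u
      unfolding *(2)[OF that]
      using that infdist_mult_z_le by (auto simp: inverse_op_coset inverse_eq_divide)
  qed (use c_pos in \<open>auto simp: infdist_nonneg\<close>)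
qed


section \<open>Spectrum and commutant\<close>

lemma resolvent_props:
  assumes "l \<in> resolvent_set univ_space A"
  defines "R \<equiv> resolvent univ_space l A"
  shows "R y \<in> domain A" and "l *\<^sub>C R y - app A (R y) = y" and "R \<in> commutant univ_space A"
proof -
  have bij: "bij_betw (\<lambda>x. l *\<^sub>C x - app A x) (domain A) UNIV"
    and R: "R \<in> bounded_ops univ_space"
    and R_def': "R = inv_into (domain A) (\<lambda>x. l *\<^sub>C x - app A x)"
    using assms(1)
    by (simp_all add: resolvent_set_def op_invertible_def op_inverse_def shifted_def R_def resolvent_def)
  show dom: "R y \<in> domain A" and right: "l *\<^sub>C R y - app A (R y) = y" for y
    unfolding R_def' using bij
    by (auto simp: bij_betw_def intro: inv_into_into f_inv_into_f)
  have "R (l *\<^sub>C x - app A x) = x" if "x \<in> domain A" for x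
    unfolding R_def' using inv_into_f_f[OF bij_betw_imp_inj_on[OF bij] that] by simp
  then have "app A (R x) = R (app A x)" if "x \<in> domain A" for x
    using right[of x] bounded_ops_univ_spaceD(3,4)[OF R] that
    by (metis add_diff_cancel_left' diff_add_cancel)
  then show "R \<in> commutant univ_space A"
    using R dom by (simp add: commutant_def)
qed

text \<open>
  For \<open>g = R f\<close> the relation \<open>g = z A g\<close> gives \<open>B [g] = [A g] = [\<lambda> g - f]\<close>, so the lifted resolvent
  is a right inverse of \<open>\<lambda> - B\<close>. It commutes with the inverse of \<open>B\<close>, hence is a left inverse too.
\<close>

lemma resolvent_B:
  assumes l: "l \<in> resolvent_set univ_space A"
  shows "l \<in> resolvent_set Y.Quot B"
    and "u \<in> pts Y.Quot \<Longrightarrow> lift (resolvent univ_space l A) u = resolvent Y.Quot l B u"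
proof -
  define R where "R = resolvent univ_space l A"
  note R = resolvent_props[OF l, folded R_def]
  note R_lin = bounded_ops_univ_spaceD[OF commutant_bounded_ops[OF R(3)]]
  have key: "lift R (coset f) = inverse_op (coset (l *\<^sub>C ell1_map R f - f))" for f
    unfolding lift_coset[OF R(3)] inverse_op_coset
    using R(1,2) by (intro coset_eq_mult_z) (simp_all add: coeff_ell1_map R_lin(1) algebra_simps)
  have app_lift: "app B (lift R (coset f)) = coset (l *\<^sub>C ell1_map R f - f)" for f
    unfolding key by (rule app_B) simp
  have app_shifted: "app (shifted Y.Quot l B) (inverse_op (coset f)) = coset (l *\<^sub>C mult_z f - f)" for f
    unfolding shifted_def oper.simps app_B[OF Y.q_pts] by (simp add: inverse_op_coset)
  have ran: "lift R ` pts Y.Quot \<subseteq> domain (shifted Y.Quot l B)"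
    by (auto simp: shifted_def domain_B key)
  have app: "app (shifted Y.Quot l B) ` domain (shifted Y.Quot l B) \<subseteq> pts Y.Quot"
  proof
    fix w
    assume "w \<in> app (shifted Y.Quot l B) ` domain (shifted Y.Quot l B)"
    then obtain f where "w = app (shifted Y.Quot l B) (inverse_op (coset f))"
      by (auto simp: shifted_def domain_B)
    then show "w \<in> pts Y.Quot"
      by (simp add: app_shifted)
  qed
  have right: "app (shifted Y.Quot l B) (lift R u) = u" if u_pts: "u \<in> pts Y.Quot" for u
  proof -
    obtain f where u: "u = coset f"
      using u_pts by auto
    show ?thesis
      unfolding u shifted_def oper.simps app_lift unfolding lift_coset[OF R(3)] by simp
  qed
  have left: "lift R (app (shifted Y.Quot l B) v) = v" if v_dom: "v \<in> domain (shifted Y.Quot l B)" for v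
  proof -
    obtain f where v: "v = inverse_op (coset f)"
      using v_dom by (auto simp: shifted_def domain_B)
    have "lift R (app (shifted Y.Quot l B) v) = lift R (coset (l *\<^sub>C mult_z f - f))"
      by (simp only: v app_shifted)
    also have "\<dots> = coset (mult_z (l *\<^sub>C ell1_map R f) - ell1_map R f)"
      using bounded_ops_univ_spaceD[OF ell1_map_bounded_ops[OF commutant_bounded_ops[OF R(3)]]]
      by (simp add: lift_coset[OF R(3)] ell1_map_mult_z commutant_bounded_ops[OF R(3)] mult_z_linear)
    also have "\<dots> = v"
      using key[of f] Y.minus_M
      unfolding v inverse_op_coset lift_coset[OF R(3)] Y.q_eq_iff
      by (force simp: mult_z_linear algebra_simps)
    finally show ?thesis .
  qed
  note inverse = op_invertibleI[OF lift_bounded_ops[OF R(3)] ran app right left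
      Y.complex_banach_space_Quot]
  have "op_invertible Y.Quot (shifted Y.Quot l B)"
    by (rule inverse(1))
  then show "l \<in> resolvent_set Y.Quot B"
    by (simp add: resolvent_set_def)
  show "lift (resolvent univ_space l A) u = resolvent Y.Quot l B u" if "u \<in> pts Y.Quot"
    unfolding resolvent_def[of Y.Quot] R_def[symmetric] by (rule inverse(2)[symmetric]) (assumption | rule that)+
qed

text \<open>
  Norms do not increase since a coefficientwise operator preserves the relations, and they do not
  decrease since the lift extends the given operator.
\<close>

lemma op_norm_lift:
  assumes "U \<in> commutant univ_space A"
  shows "op_norm Y.Quot (lift U) = op_norm univ_space U"
proof (rule antisym)
  note U = bounded_ops_univ_spaceD[OF commutant_bounded_ops[OF assms]]
  have le: "vnorm Y.Quot (lift U u) \<le> onorm U * vnorm Y.Quot u" if "u \<in> pts Y.Quot" for u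
  proof -
    have "infdist (ell1_map U f) (closure relations) \<le> onorm U * infdist f (closure relations)" for f
      by (intro Y.infdist_image_le ell1_map_bounded_ops commutant_bounded_ops ell1_map_relations
          assms norm_ell1_map_le onorm onorm_pos_le U)
    with that show ?thesis
      by (auto simp: lift_coset assms)
  qed
  show "op_norm Y.Quot (lift U) \<le> op_norm univ_space U"
    unfolding op_norm_univ_space
    by (rule op_norm_le) (use le onorm_pos_le[OF U(1)] in \<open>auto simp: infdist_nonneg\<close>)
  show "op_norm univ_space U \<le> op_norm Y.Quot (lift U)"
    unfolding op_norm_def
  proof (rule cSUP_mono)
    show "bdd_above ((\<lambda>u. vnorm Y.Quot (lift U u) / vnorm Y.Quot u) ` pts Y.Quot)"
    proof (rule bdd_aboveI2)
      show "vnorm Y.Quot (lift U u) / vnorm Y.Quot u \<le> onorm U" if "u \<in> pts Y.Quot" for u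
        using le[OF that] that onorm_pos_le[OF U(1)]
        by (cases "vnorm Y.Quot u = 0") (auto simp: divide_le_eq less_le infdist_nonneg)
    qed
    show "\<exists>u\<in>pts Y.Quot. vnorm univ_space (U x) / vnorm univ_space x \<le>
        vnorm Y.Quot (lift U u) / vnorm Y.Quot u" for x
    proof (rule bexI[of _ "embed x"])
      show "vnorm univ_space (U x) / vnorm univ_space x \<le>
          vnorm Y.Quot (lift U (embed x)) / vnorm Y.Quot (embed x)"
        unfolding lift_embed[OF assms] by (simp add: embed_def infdist_single)
    qed (simp add: embed_def)
  qed simp
qed

lemma unital_isometric_hom_lift:
  "unital_isometric_hom univ_space (commutant univ_space A) Y.Quot lift"
  unfolding unital_isometric_hom_def
proof (intro conjI ballI allI)
  show "lift ` commutant univ_space A \<subseteq> bounded_ops Y.Quot"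
    using lift_bounded_ops by blast
  have id: "(\<lambda>x. x) \<in> commutant univ_space A"
    by (auto simp: commutant_def bounded_ops_univ_space)
  show "lift (\<lambda>x. x) u = u" if "u \<in> pts Y.Quot" for u
  proof -
    have "ell1_map (\<lambda>x. x) f = f" for f :: "'a ell1"
      by (intro ell1_eqI) (simp add: coeff_ell1_map)
    with that show ?thesis
      by (auto simp: lift_coset id)
  qed
  note lin = bounded_ops_univ_spaceD[OF commutant_bounded_ops]
  show "lift (\<lambda>x. vadd univ_space (S x) (U x)) u = vadd Y.Quot (lift S u) (lift U u)"
    if S: "S \<in> commutant univ_space A" and U: "U \<in> commutant univ_space A" and u: "u \<in> pts Y.Quot"
    for S U u
  proof -
    have "(\<lambda>x. S x + U x) \<in> commutant univ_space A"
      using S U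
      by (auto simp: commutant_def bounded_ops_univ_space bounded_linear_add scaleC_add_right
          domain_add app_add)
    moreover have "ell1_map (\<lambda>x. S x + U x) f = ell1_map S f + ell1_map U f" for f
      by (intro ell1_eqI) (simp add: coeff_ell1_map bounded_linear_add lin(1)[OF S] lin(1)[OF U])
    ultimately show ?thesis
      using u by (auto simp: lift_coset S U)
  qed
  show "lift (\<lambda>x. vscale univ_space a (U x)) u = vscale Y.Quot a (lift U u)"
    if U: "U \<in> commutant univ_space A" and u: "u \<in> pts Y.Quot" for a U u
  proof -
    have "(\<lambda>x. a *\<^sub>C U x) \<in> commutant univ_space A"
      using U bounded_linear_compose[OF bounded_linear_scaleC]
      by (auto simp: commutant_def bounded_ops_univ_space scaleC_scaleC mult.commute
          domain_scaleC app_scaleC)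
    moreover have "ell1_map (\<lambda>x. a *\<^sub>C U x) f = a *\<^sub>C ell1_map U f" for f
      using bounded_linear_compose[OF bounded_linear_scaleC lin(1)[OF U]]
      by (intro ell1_eqI) (simp add: coeff_ell1_map lin(1)[OF U])
    ultimately show ?thesis
      using u by (auto simp: lift_coset U)
  qed
  show "lift (\<lambda>x. S (U x)) u = lift S (lift U u)"
    if S: "S \<in> commutant univ_space A" and U: "U \<in> commutant univ_space A" and u: "u \<in> pts Y.Quot"
    for S U u
  proof -
    have "(\<lambda>x. S (U x)) \<in> commutant univ_space A"
      using S U bounded_linear_compose by (auto simp: commutant_def bounded_ops_univ_space)
    moreover have "ell1_map (\<lambda>x. S (U x)) f = ell1_map S (ell1_map U f)" for f
      using bounded_linear_compose[OF lin(1)[OF S] lin(1)[OF U]]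
      by (intro ell1_eqI) (simp add: coeff_ell1_map lin(1)[OF S] lin(1)[OF U])
    ultimately show ?thesis
      using u by (auto simp: lift_coset S U)
  qed
  show "op_norm Y.Quot (lift U) = op_norm univ_space U" if "U \<in> commutant univ_space A" for U
    by (rule op_norm_lift[OF that])
qed

end

theorem theorem3p2:
  fixes A :: "'a::cbanach oper" and c :: real
  assumes "operator_on univ_space A"
    and "generates_C0_semigroup univ_space A"
    and "c > 0"
    and "\<forall>x\<in>domain A. norm (app A x) \<ge> c * norm x"
  shows "\<exists>(Y :: (nat \<Rightarrow> 'a) set cspace) j B \<phi>.
      complex_banach_space Y \<and> isometric_embedding univ_space Y j \<and> operator_on Y B \<and>
      generates_C0_semigroup Y B \<and>
      outer_extension univ_space j A B \<and>
      op_invertible Y B \<and> op_norm Y (op_inverse B) \<le> inverse c \<and>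
      op_spectrum Y B \<subseteq> op_spectrum univ_space A \<and>
      unital_isometric_hom univ_space (commutant univ_space A) Y \<phi> \<and>
      (\<forall>U\<in>commutant univ_space A. \<forall>x. \<phi> U (j x) = j (U x)) \<and>
      (\<forall>l\<in>resolvent_set univ_space A. \<forall>y\<in>pts Y.
         \<phi> (resolvent univ_space l A) y = resolvent Y l B y)"
proof -
  obtain T where "C0_semigroup univ_space T" "generator_of univ_space T A"
    using assms(2) unfolding generates_C0_semigroup_def by blast
  then interpret bounded_below_generator T A c
    using assms(1,3,4) by unfold_locales auto
  have "generates_C0_semigroup Y.Quot B"
    unfolding generates_C0_semigroup_def using C0_semigroup_T_ext generator_of_T_ext by blast
  moreover have "op_spectrum Y.Quot B \<subseteq> op_spectrum univ_space A"
    using resolvent_B(1) by (auto simp: op_spectrum_def)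
  ultimately show ?thesis
    by (intro exI[of _ Y.Quot] exI[of _ embed] exI[of _ B] exI[of _ lift])
      (auto simp only: Y.complex_banach_space_Quot isometric_embedding_embed operator_on_B
        outer_extension_B invertible_B unital_isometric_hom_lift lift_embed resolvent_B(2))
qed

end
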